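(* Let $F:\mathbb{R}\to\mathbb{R}$ be smooth, let $x_0\in\mathbb{R}$ and $u_L<u_R$, and consider the Riemann problem $u_t+(F(u))_x=0$ with $u(x,0)=u_L$ for $x<x_0$ and $u(x,0)=u_R$ for $x>x_0$. Then the Generalized Equal-Area Principle (the algorithm described in the context), applied at time $\tau>0$, generates a weak solution of this Riemann problem which corresponds exactly to the lower convex hull function $LconF$ of $F$ on $[u_L,u_R]$, in the following sense: each vertical line of the generated solution between heights $u$ and $u^*$ corresponds to a secant line of $LconF$ from $(u,F(u))$ to $(u^*,F(u^* ))$ (that is, $LconF$ coincides on the interval between $u$ and $u^*$ with the affine function through these two points), while the remaining portions of the generated curve correspond to intervals of heights where $LconF(u)=F(u)$.
   Context: **Lower convex hull.** For $u\in[u_L,u_R]$, $LconF(u)=\sup\{au+b : (a,b)\in\mathbb{R}^2,\ av+b\le F(v)\ \forall v\in[u_L,u_R]\}$. **Flowed curve.** The initial data is viewed as a planar curve consisting, traversed in this order, of the left state $\langle x_0-r,u_L\rangle$ ($r\ge0$, $r$ decreasing to $0$), the wave front $\langle x_0,u_Rs+(1-s)u_L\rangle$ ($s\in[0,1]$ increasing), and the right state $\langle x_0+q,u_R\rangle$ ($q\ge0$ increasing). Under the characteristic flow $\dot x=F'(u)$, $\dot u=0$ for time $\tau>0$ it becomes the curve consisting of the left state $\langle x_0-r+F'(u_L)\tau,u_L\rangle$, $r\ge 0$, the front $\langle x_0+F'(u_Rs+(1-s)u_L)\tau,\,u_Rs+(1-s)u_L\rangle$, $s\in[0,1]$, and the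 right state $\langle x_0+q+F'(u_R)\tau,u_R\rangle$, $q\ge0$. **Equal-area curves.** A sub-arc $\langle x(s),u(s)\rangle$, $s\in[s_0,s_1]$, of this piecewise smooth curve is an equal-area curve if $x(s_0)=x(s_1)$ and $\int_{s_0}^{s_1}u(s)x'(s)\,ds=0$ (summed over the smooth pieces). The common value $x(s_0)=x(s_1)$ is its shock position; the sub-arc may be replaced by the vertical line (shock) at that position. An equal-area curve connects to $u_R$ if its final endpoint lies on the right state, and connects to $u_L$ if its initial endpoint lies on the left state; an equal-area curve from $u_L$ to $u_R$ starts on the left state and ends on the right state. **Generalized Equal-Area Principle.** (1) Form the flowed curve at time $\tau$, that is, the curve consisting of the left state $\langle x_0-r+F'(u_L)\tau,u_L\rangle$, $r\ge 0$, the front $\langle x_0+F'(u_Rs+(1-s)u_L)\tau,\,u_Rs+(1-s)u_L\rangle$, $s\in[0,1]$, and the right state $\langle x_0+q+F'(u_R)\tau,u_R\rangle$, $q\ge0$. (2) Search for equal-area curves from front points with parameter $s^*\in(0,1)$ to the state $u_R$, and also check for an equal-area curve from $u_L$ to $u_R$. If such curves exist, select the one with the largest shock position. If it is from $u_L$ to $u_R$, replace the whole front by the vertical line at position $x_0+\sigma\tau$, $\sigma=\frac{F(u_L)-F(u_R)}{u_L-u_R}$, restrict the left state to $r\ge(F'(u_L)-\sigma)\tau$ and the right state to $q\ge(\sigma-F'(u_R))\tau$, and stop. If it starts at parameter $s^*\in(0,1)$, replace the front for $s\in[s^*,1]$ by the vertical line at position $x_0+F'(u_Rs^*+(1-s^*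 )u_L)\tau$ and restrict the right state to $q\ge(F'(u_Rs^*+(1-s^* )u_L)-F'(u_R))\tau$. If no shock to $u_R$ exists, set $s^*=1$. (3) Search for the largest $\hat s\in(0,s^*]$ such that there is an equal-area curve whose final endpoint is the front point with parameter $\hat s$. If none exists, stop. If the equal-area curve connects to $u_L$, replace the front for $s\in[0,\hat s]$ by the vertical line at position $x_0+F'(u_R\hat s+(1-\hat s)u_L)\tau$, restrict the left state to $r\ge(F'(u_L)-F'(u_R\hat s+(1-\hat s)u_L))\tau$, and stop. Otherwise the equal-area curve starts at a front point with parameter $s^{**}\in(0,\hat s)$; replace the front for $s\in[s^{**},\hat s]$ by the vertical line at position $x_0+F'(u_R\hat s+(1-\hat s)u_L)\tau$, and repeat step (3) with $s^{**}$ in the role of $s^*$.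
   Formalization: That the algorithm finishes is claimed only when LconF has finitely many maximal secant lines, and for some choice among non-unique equal-area curves; otherwise it need not terminate or a largest ŝ may not exist. The other claims hold for every run that finishes. *)

theory Defs
  imports "HOL-Analysis.Analysis"
begin

definition smooth :: "(real \<Rightarrow> real) \<Rightarrow> bool" where
  "smooth F \<longleftrightarrow> (\<forall>n x. (deriv ^^ n) F differentiable (at x))"

definition LconF :: "(real \<Rightarrow> real) \<Rightarrow> real \<Rightarrow> real \<Rightarrow> real \<Rightarrow> real" where
  "LconF F uL uR u = Sup {a * u + b | a b. \<forall>v\<in>{uL..uR}. a * v + b \<le> F v}"

definition hull_secant :: "(real \<Rightarrow> real) \<Rightarrow> real \<Rightarrow> real \<Rightarrow> real \<Rightarrow> real \<Rightarrow> bool" where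
  "hull_secant F uL uR a b \<longleftrightarrow> uL \<le> a \<and> a < b \<and> b \<le> uR \<and>
     (\<forall>v\<in>{a..b}. LconF F uL uR v = F a + (F b - F a) / (b - a) * (v - a))"

definition maximal_hull_secants :: "(real \<Rightarrow> real) \<Rightarrow> real \<Rightarrow> real \<Rightarrow> (real \<times> real) set" where
  "maximal_hull_secants F uL uR =
     {(a, b). hull_secant F uL uR a b \<and>
       (\<forall>a' b'. hull_secant F uL uR a' b' \<and> a' \<le> a \<and> b \<le> b' \<longrightarrow> a' = a \<and> b' = b)}"

text \<open>
  The whole flowed curve is parametrised by one real number \<open>p\<close>: the left state is \<open>p \<le> 0\<close> with
  \<open>r = - p\<close>, the front is \<open>0 \<le> p \<le> 1\<close> with \<open>s = p\<close>, and the right state is \<open>p \<ge> 1\<close> with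
  \<open>q = p - 1\<close>.
\<close>

definition flow_u :: "real \<Rightarrow> real \<Rightarrow> real \<Rightarrow> real" where
  "flow_u uL uR p =
     (if p \<le> 0 then uL else if p \<le> 1 then uR * p + (1 - p) * uL else uR)"

definition flow_x :: "(real \<Rightarrow> real) \<Rightarrow> real \<Rightarrow> real \<Rightarrow> real \<Rightarrow> real \<Rightarrow> real \<Rightarrow> real" where
  "flow_x F x0 uL uR \<tau> p =
     (if p \<le> 0 then x0 + p + deriv F uL * \<tau>
      else if p \<le> 1 then x0 + deriv F (uR * p + (1 - p) * uL) * \<tau>
      else x0 + (p - 1) + deriv F uR * \<tau>)"

text \<open>
  At the two junctions \<open>p = 0\<close> and \<open>p = 1\<close> the derivative of \<open>flow_x\<close> need not exist; these two
  points do not affect the integral, which is therefore the sum over the smooth pieces.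
\<close>

definition equal_area ::
  "(real \<Rightarrow> real) \<Rightarrow> real \<Rightarrow> real \<Rightarrow> real \<Rightarrow> real \<Rightarrow> real \<Rightarrow> real \<Rightarrow> bool" where
  "equal_area F x0 uL uR \<tau> p0 p1 \<longleftrightarrow> p0 < p1 \<and>
     flow_x F x0 uL uR \<tau> p0 = flow_x F x0 uL uR \<tau> p1 \<and>
     integral {p0..p1} (\<lambda>p. flow_u uL uR p * deriv (flow_x F x0 uL uR \<tau>) p) = 0"

text \<open>
  A curve in the course of the algorithm is a pair \<open>(K, V)\<close>: \<open>K\<close> is the set of parameters of the
  flowed curve that have not been removed, and \<open>V\<close> is the set of inserted vertical lines
  \<open>(y, a, b)\<close> at position \<open>y\<close> from height \<open>a\<close> to height \<open>b\<close>.
\<close>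

type_synonym shock_curve = "real set \<times> (real \<times> real \<times> real) set"

definition curve_points ::
  "(real \<Rightarrow> real) \<Rightarrow> real \<Rightarrow> real \<Rightarrow> real \<Rightarrow> real \<Rightarrow> shock_curve \<Rightarrow> (real \<times> real) set" where
  "curve_points F x0 uL uR \<tau> C =
     {(flow_x F x0 uL uR \<tau> p, flow_u uL uR p) | p. p \<in> fst C} \<union>
     {(y, h). \<exists>a b. (y, a, b) \<in> snd C \<and> a \<le> h \<and> h \<le> b}"

definition shock_to_right ::
  "(real \<Rightarrow> real) \<Rightarrow> real \<Rightarrow> real \<Rightarrow> real \<Rightarrow> real \<Rightarrow> real \<Rightarrow> bool" where
  "shock_to_right F x0 uL uR \<tau> p0 \<longleftrightarrow> p0 < 1 \<and> (\<exists>p1\<ge>1. equal_area F x0 uL uR \<tau> p0 p1)"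

definition selected_shock_to_right ::
  "(real \<Rightarrow> real) \<Rightarrow> real \<Rightarrow> real \<Rightarrow> real \<Rightarrow> real \<Rightarrow> real \<Rightarrow> bool" where
  "selected_shock_to_right F x0 uL uR \<tau> p0 \<longleftrightarrow> shock_to_right F x0 uL uR \<tau> p0 \<and>
     (\<forall>p. shock_to_right F x0 uL uR \<tau> p \<longrightarrow> flow_x F x0 uL uR \<tau> p \<le> flow_x F x0 uL uR \<tau> p0)"

definition front_end ::
  "(real \<Rightarrow> real) \<Rightarrow> real \<Rightarrow> real \<Rightarrow> real \<Rightarrow> real \<Rightarrow> real \<Rightarrow> real \<Rightarrow> bool" where
  "front_end F x0 uL uR \<tau> s t \<longleftrightarrow> 0 < t \<and> t \<le> s \<and> (\<exists>p0. equal_area F x0 uL uR \<tau> p0 t)"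

definition largest_front_end ::
  "(real \<Rightarrow> real) \<Rightarrow> real \<Rightarrow> real \<Rightarrow> real \<Rightarrow> real \<Rightarrow> real \<Rightarrow> real \<Rightarrow> bool" where
  "largest_front_end F x0 uL uR \<tau> s t \<longleftrightarrow> front_end F x0 uL uR \<tau> s t \<and>
     (\<forall>t'. front_end F x0 uL uR \<tau> s t' \<longrightarrow> t' \<le> t)"

text \<open>
  \<open>geap_front F x0 uL uR \<tau> s C D\<close>: the iteration along the front, started at parameter \<open>s\<close>
  with the curve \<open>C\<close>, stops with the curve \<open>D\<close>. Where several equal-area curves are
  admissible, any of them may be taken. Restricting the left state to \<open>r \<ge> \<rho>\<close> means
  removing the parameters \<open>- \<rho> < p \<le> 0\<close>.
\<close>

inductive geap_front ::
  "(real \<Rightarrow> real) \<Rightarrow> real \<Rightarrow> real \<Rightarrow> real \<Rightarrow> real \<Rightarrow> real \<Rightarrow> shock_curve \<Rightarrow> shock_curve \<Rightarrow> bool"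
  for F :: "real \<Rightarrow> real" and x0 uL uR \<tau> :: real
where
  stop: "(\<nexists>t. front_end F x0 uL uR \<tau> s t) \<Longrightarrow> geap_front F x0 uL uR \<tau> s C C"
| to_left: "largest_front_end F x0 uL uR \<tau> s t \<Longrightarrow> p0 \<le> 0 \<Longrightarrow> equal_area F x0 uL uR \<tau> p0 t \<Longrightarrow>
    geap_front F x0 uL uR \<tau> s (K, V)
      (K - {- ((deriv F uL - deriv F (flow_u uL uR t)) * \<tau>) <.. t},
       insert (x0 + deriv F (flow_u uL uR t) * \<tau>, uL, flow_u uL uR t) V)"
| inner: "largest_front_end F x0 uL uR \<tau> s t \<Longrightarrow> 0 < s' \<Longrightarrow> equal_area F x0 uL uR \<tau> s' t \<Longrightarrow>
    geap_front F x0 uL uR \<tau> s'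
      (K - {s'..t},
       insert (x0 + deriv F (flow_u uL uR t) * \<tau>, flow_u uL uR s', flow_u uL uR t) V) D \<Longrightarrow>
    geap_front F x0 uL uR \<tau> s (K, V) D"

text \<open>
  \<open>geap F x0 uL uR \<tau> C\<close>: the Generalized Equal-Area Principle applied at time \<open>\<tau>\<close> can
  terminate with the curve \<open>C\<close>.
\<close>

inductive geap ::
  "(real \<Rightarrow> real) \<Rightarrow> real \<Rightarrow> real \<Rightarrow> real \<Rightarrow> real \<Rightarrow> shock_curve \<Rightarrow> bool"
  for F :: "real \<Rightarrow> real" and x0 uL uR \<tau> :: real
where
  whole: "selected_shock_to_right F x0 uL uR \<tau> p0 \<Longrightarrow> p0 \<le> 0 \<Longrightarrow>
    \<sigma> = (F uL - F uR) / (uL - uR) \<Longrightarrow>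
    geap F x0 uL uR \<tau>
      (UNIV - {- ((deriv F uL - \<sigma>) * \<tau>) <..< 1 + (\<sigma> - deriv F uR) * \<tau>},
       {(x0 + \<sigma> * \<tau>, uL, uR)})"
| to_right: "selected_shock_to_right F x0 uL uR \<tau> s \<Longrightarrow> 0 < s \<Longrightarrow>
    geap_front F x0 uL uR \<tau> s
      (UNIV - {s ..< 1 + (deriv F (flow_u uL uR s) - deriv F uR) * \<tau>},
       {(x0 + deriv F (flow_u uL uR s) * \<tau>, flow_u uL uR s, uR)}) C \<Longrightarrow>
    geap F x0 uL uR \<tau> C"
| no_shock: "(\<nexists>p. shock_to_right F x0 uL uR \<tau> p) \<Longrightarrow>
    geap_front F x0 uL uR \<tau> 1 (UNIV, {}) C \<Longrightarrow> geap F x0 uL uR \<tau> C"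

text \<open>
  Test functions are the compactly supported \<open>C\<^sup>1\<close> functions on the plane, not required to
  vanish at \<open>t = 0\<close>; \<open>\<phi>x\<close> and \<open>\<phi>t\<close> are the partial derivatives.
\<close>

definition test_function ::
  "(real \<times> real \<Rightarrow> real) \<Rightarrow> (real \<times> real \<Rightarrow> real) \<Rightarrow> (real \<times> real \<Rightarrow> real) \<Rightarrow> bool" where
  "test_function \<phi> \<phi>x \<phi>t \<longleftrightarrow>
     (\<forall>x t. ((\<lambda>y. \<phi> (y, t)) has_real_derivative \<phi>x (x, t)) (at x)) \<and>
     (\<forall>x t. ((\<lambda>s. \<phi> (x, s)) has_real_derivative \<phi>t (x, t)) (at t)) \<and>
     continuous_on UNIV \<phi>x \<and> continuous_on UNIV \<phi>t \<and>
     compact (closure {z. \<phi> z \<noteq> 0})"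

definition weak_solution ::
  "(real \<Rightarrow> real) \<Rightarrow> (real \<Rightarrow> real) \<Rightarrow> (real \<Rightarrow> real \<Rightarrow> real) \<Rightarrow> bool" where
  "weak_solution F u0 u \<longleftrightarrow>
     (\<lambda>(x, t). u x t) \<in> borel_measurable (lebesgue_on (UNIV \<times> {0<..})) \<and>
     (\<exists>B. \<forall>x. \<forall>t>0. \<bar>u x t\<bar> \<le> B) \<and>
     (\<forall>\<phi> \<phi>x \<phi>t. test_function \<phi> \<phi>x \<phi>t \<longrightarrow>
        (LINT (x, t)|lebesgue_on (UNIV \<times> {0<..}). u x t * \<phi>t (x, t) + F (u x t) * \<phi>x (x, t)) +
        (LINT x|lebesgue. u0 x * \<phi> (x, 0)) = 0)"

end

(*
  Write M(xi) for the set of minimisers of F v - xi * v over [uL, uR]; it consists of the points at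
  which the supporting line of slope xi touches the graph of F. The secants of the hull are the pairs
  of distinct points of a common M(xi), and F agrees with the hull on the union of all M(xi).

  Parametrise positions by speeds xi = (x - x0) / tau. Integrating u x' by parts, an arc of the
  flowed curve is an equal-area curve iff its end points have the same speed xi and the same value of
  F v - xi * v, so every hull secant comes from an equal-area curve. Conversely, if u(s) is a contact
  point and no equal-area curve ends in (t, s], then there is no hull secant over this part of the
  front, all its heights are contact points, and hence so is u(t); an equal-area curve ending at t
  then has both ends in M(F'(u(t))). Thus the algorithm only produces hull secants, and it leaves
  exactly one height at every position that is not a shock. If there are finitely many maximal
  secants, each step can be chosen to use up one of them.

  The resulting u(x, t) is w((x - x0) / t) off countably many rays, where w(xi) is in M(xi). For
  speeds a < b minimality gives a [w] <= [F(w)] <= b [w] for the jumps between a and b, so a staircase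
  approximation of w violates the Rankine-Hugoniot condition by at most the mesh size times the total
  variation, and the weak formulation follows by dominated convergence.
*)

theory Submission
  imports Defs
begin

section \<open>Supporting lines of the lower convex hull\<close>

text \<open>The equal-area condition only says that two points of the graph of F lie on a line whose
  slope is their common speed; nothing in it keeps that line below F. Support comes from the
  extremal choices: a shock to uR that is off the hull is overtaken by one further right, and below
  a parameter known to be a contact point, a hull secant over the front gives an arc whose end the
  search for the largest end cannot overlook. Contact is thus handed on from right to left, arc by
  arc. Two obstacles shape the details. Inner contact points determine their slope, but uL and uR
  are contact points for whole half-lines of slopes; the constant states supply the points for
  these, and the ends of the front need separate clauses. Moreover, a run may choose an arc shorter
  than the maximal secant, so that several vertical lines share one position. The invariant
  therefore speaks of secants and covered heights, never of maximal secants. Finiteness enters only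
  where a run is constructed: there the supremum of the arc ends must be attained and the iteration
  must end.\<close>

locale riemann_problem =
  fixes F :: "real \<Rightarrow> real" and uL uR :: real
  assumes smooth: "smooth F" and uL_less_uR: "uL < uR"
begin

abbreviation f :: "real \<Rightarrow> real" where "f \<equiv> deriv F"

lemma has_real_derivative_F: "(F has_real_derivative f v) (at v)"
proof -
  have "(deriv ^^ 0) F differentiable (at v)"
    using smooth unfolding smooth_def by blast
  then show ?thesis
    using DERIV_deriv_iff_real_differentiable by auto
qed

lemma has_real_derivative_f: "(f has_real_derivative deriv f v) (at v)"
proof -
  have "(deriv ^^ 1) F differentiable (at v)"
    using smooth unfolding smooth_def by blast
  then show ?thesis
    using DERIV_deriv_iff_real_differentiable by auto
qed

lemma continuous_on_F [continuous_intros]: "continuous_on S F"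
  using has_real_derivative_F DERIV_isCont continuous_at_imp_continuous_on by blast

lemma continuous_on_f [continuous_intros]: "continuous_on S f"
  using has_real_derivative_f DERIV_isCont continuous_at_imp_continuous_on by blast

text \<open>The points where the Legendre transform of F over {uL..uR} attains its supremum at
  \<open>\<xi>\<close>. As for any such argmax, monotonicity in \<open>\<xi>\<close> is what
  everything rests on.\<close>

definition contact :: "real \<Rightarrow> real set" where
  "contact \<xi> = {v \<in> {uL..uR}. \<forall>w\<in>{uL..uR}. F v - \<xi> * v \<le> F w - \<xi> * w}"

lemma contactD:
  assumes "v \<in> contact \<xi>"
  shows "uL \<le> v" "v \<le> uR" "\<And>w. uL \<le> w \<Longrightarrow> w \<le> uR \<Longrightarrow> F v - \<xi> * v \<le> F w - \<xi> * w"
  using assms by (auto simp: contact_def)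

lemma contact_eq:
  assumes "a \<in> contact \<xi>" "b \<in> contact \<xi>"
  shows "F a - \<xi> * a = F b - \<xi> * b"
  using contactD[OF assms(1)] contactD[OF assms(2)] by (meson antisym)

lemma contact_slope:
  assumes "a \<in> contact \<xi>" "b \<in> contact \<xi>" "a < b"
  shows "\<xi> = (F b - F a) / (b - a)"
  using contact_eq[OF assms(1,2)] assms(3) by (simp add: field_simps)

lemma contact_transfer:
  assumes "b \<in> contact \<xi>" "uL \<le> a" "a \<le> uR" "F a - \<xi> * a = F b - \<xi> * b"
  shows "a \<in> contact \<xi>"
  using assms by (auto simp: contact_def)

lemma contact_nonempty: "\<exists>v. v \<in> contact \<xi>"
proof -
  have "\<exists>v\<in>{uL..uR}. \<forall>w\<in>{uL..uR}. F v - \<xi> * v \<le> F w - \<xi> * w"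
    using uL_less_uR by (intro continuous_attains_inf continuous_intros) auto
  then show ?thesis
    by (auto simp: contact_def)
qed

text \<open>Adding the two minimality inequalities cancels F.\<close>

lemma contact_mono:
  assumes "a \<in> contact \<sigma>" "b \<in> contact \<sigma>'" "\<sigma> < \<sigma>'"
  shows "a \<le> b"
proof -
  have "F a - \<sigma> * a \<le> F b - \<sigma> * b" "F b - \<sigma>' * b \<le> F a - \<sigma>' * a"
    using assms by (auto simp: contact_def)
  then have "(\<sigma>' - \<sigma>) * a \<le> (\<sigma>' - \<sigma>) * b"
    by (simp add: algebra_simps)
  with assms show ?thesis
    by simp
qed

text \<open>First-order condition for a minimiser that can still move to the right. At uL and uR
  only one of the two one-sided conditions survives; the gap it leaves between slope and
  \<open>f\<close>, times \<tau>, is the length that a shock cuts off a constant state.\<close>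

lemma contact_slope_le:
  assumes "v \<in> contact \<sigma>" "v < uR"
  shows "\<sigma> \<le> f v"
proof (rule ccontr)
  assume "\<not> \<sigma> \<le> f v"
  moreover have "((\<lambda>w. F w - \<sigma> * w) has_real_derivative f v - \<sigma>) (at v)"
    by (auto intro!: derivative_eq_intros has_real_derivative_F)
  ultimately obtain d where d: "d > 0" "\<And>h. 0 < h \<Longrightarrow> h < d \<Longrightarrow> F (v + h) - \<sigma> * (v + h) < F v - \<sigma> * v"
    using DERIV_neg_dec_right[of "\<lambda>w. F w - \<sigma> * w" "f v - \<sigma>" v] by force
  define h where "h = min (d / 2) (uR - v)"
  have "0 < h" "h < d" "uL \<le> v + h" "v + h \<le> uR"
    using d assms by (auto simp: h_def contact_def)
  then show False
    using d(2)[of h] contactD(3)[OF assms(1), of "v + h"] by fastforce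
qed

lemma contact_slope_ge:
  assumes "v \<in> contact \<sigma>" "uL < v"
  shows "f v \<le> \<sigma>"
proof (rule ccontr)
  assume "\<not> f v \<le> \<sigma>"
  moreover have "((\<lambda>w. F w - \<sigma> * w) has_real_derivative f v - \<sigma>) (at v)"
    by (auto intro!: derivative_eq_intros has_real_derivative_F)
  ultimately obtain d where d: "d > 0" "\<And>h. 0 < h \<Longrightarrow> h < d \<Longrightarrow> F (v - h) - \<sigma> * (v - h) < F v - \<sigma> * v"
    using DERIV_pos_inc_left[of "\<lambda>w. F w - \<sigma> * w" "f v - \<sigma>" v] by force
  define h where "h = min (d / 2) (v - uL)"
  have "0 < h" "h < d" "uL \<le> v - h" "v - h \<le> uR"
    using d assms by (auto simp: h_def contact_def)
  then show False
    using d(2)[of h] contactD(3)[OF assms(1), of "v - h"] by fastforce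
qed

lemma contact_slope_eq:
  assumes "v \<in> contact \<sigma>" "uL < v" "v < uR"
  shows "\<sigma> = f v"
  using contact_slope_le contact_slope_ge assms by force

text \<open>Contact points of a slope other than \<sigma> all lie on one side of those of \<sigma>,
  so c could only be an end point.\<close>

lemma contact_between:
  assumes "a \<in> contact \<sigma>" "b \<in> contact \<sigma>" "c \<in> contact \<zeta>" "a \<le> c" "c \<le> b"
  shows "c \<in> contact \<sigma>"
proof (cases "\<sigma> = \<zeta>")
  case False
  then consider "\<sigma> < \<zeta>" | "\<zeta> < \<sigma>" by linarith
  then have "c = a \<or> c = b"
    by cases (use contact_mono assms in force)+
  then show ?thesis
    using assms by auto
qed (use assms in auto)

text \<open>The contact relation is closed in the plane and is projected along a compact
  factor.\<close>

lemma closed_contact_slopes: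
  assumes "compact S"
  shows "closed {\<xi>. \<exists>v\<in>S. v \<in> contact \<xi>}"
proof -
  have "closed (\<Inter>w\<in>{uL..uR}. {z. F (fst z) - snd z * fst z \<le> F w - snd z * w})"
    by (intro closed_INT ballI closed_Collect_le continuous_intros
        continuous_on_compose2[OF continuous_on_F[of UNIV]]) auto
  moreover have "compact (S \<inter> {uL..uR})"
    using assms by (simp add: compact_Int)
  ultimately have "closed {\<xi>. \<exists>v. v \<in> S \<inter> {uL..uR} \<and>
      (v, \<xi>) \<in> (\<Inter>w\<in>{uL..uR}. {z. F (fst z) - snd z * fst z \<le> F w - snd z * w})}"
    by (rule closed_compact_projection[rotated])
  then show ?thesis
    by (rule back_subst[of closed]) (auto simp: contact_def)
qed

lemma contact_left_end:
  "\<exists>R. \<forall>\<xi>\<le>R. contact \<xi> = {uL}" and contact_right_end: "\<exists>R. \<forall>\<xi>\<ge>R. contact \<xi> = {uR}"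
proof -
  have "compact (f ` {uL..uR})"
    by (intro compact_continuous_image continuous_intros) auto
  then obtain B where B: "\<And>v. v \<in> {uL..uR} \<Longrightarrow> \<bar>f v\<bar> \<le> B"
    using compact_imp_bounded[of "f ` {uL..uR}"] unfolding bounded_iff
    by (metis image_eqI real_norm_def)
  have "contact \<xi> = {uL}" if "\<xi> \<le> - B - 1" for \<xi>
  proof -
    have "v = uL" if "v \<in> contact \<xi>" for v
      using contact_slope_ge[OF that] contactD[OF that] B[of v] \<open>\<xi> \<le> - B - 1\<close> by force
    then show ?thesis using contact_nonempty by blast
  qed
  then show "\<exists>R. \<forall>\<xi>\<le>R. contact \<xi> = {uL}" by blast
  have "contact \<xi> = {uR}" if "\<xi> \<ge> B + 1" for \<xi>
  proof -
    have "v = uR" if "v \<in> contact \<xi>" for v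
      using contact_slope_le[OF that] contactD[OF that] B[of v] \<open>\<xi> \<ge> B + 1\<close> by force
    then show ?thesis using contact_nonempty by blast
  qed
  then show "\<exists>R. \<forall>\<xi>\<ge>R. contact \<xi> = {uR}" by blast
qed

text \<open>
  The slopes with a contact point to the left of \<open>v\<close> and those with one to the right of \<open>v\<close> form
  two nonempty closed sets covering the line, which therefore meet.
\<close>

lemma contact_straddle:
  assumes "uL \<le> v" "v \<le> uR"
  obtains \<sigma> a b where "a \<in> contact \<sigma>" "b \<in> contact \<sigma>" "a \<le> v" "v \<le> b"
proof -
  let ?S = "{\<xi>. \<exists>a\<in>{uL..v}. a \<in> contact \<xi>}" and ?T = "{\<xi>. \<exists>b\<in>{v..uR}. b \<in> contact \<xi>}"
  have cl: "closed ?S" "closed ?T"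
    by (rule closed_contact_slopes; simp)+
  obtain R R' where "contact R = {uL}" "contact R' = {uR}"
    using contact_left_end contact_right_end by blast
  then have ne: "?S \<noteq> {}" "?T \<noteq> {}"
    using assms by fastforce+
  have "UNIV \<subseteq> ?S \<union> ?T"
  proof
    fix \<xi>
    obtain a where "a \<in> contact \<xi>" using contact_nonempty by blast
    then show "\<xi> \<in> ?S \<union> ?T" using contactD[of a \<xi>] by force
  qed
  then have "?S \<inter> ?T \<noteq> {}"
    using connected_closedD[OF connected_UNIV, of ?S ?T] cl ne by auto
  then obtain \<sigma> a b where "a \<in> {uL..v}" "a \<in> contact \<sigma>" "b \<in> {v..uR}" "b \<in> contact \<sigma>"
    by blast
  then show ?thesis
    using that by auto
qed

lemma compact_contact: "compact (contact \<xi>)"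
proof -
  have "uL \<in> {uL..uR}" using uL_less_uR by simp
  then have "contact \<xi> = (\<Inter>w\<in>{uL..uR}. {v\<in>{uL..uR}. F v - \<xi> * v \<le> F w - \<xi> * w})"
    unfolding contact_def by blast
  moreover have "compact {v\<in>{uL..uR}. F v - \<xi> * v \<le> F w - \<xi> * w}" for w
  proof -
    have "closed {v. F v - \<xi> * v \<le> F w - \<xi> * w}"
      by (intro closed_Collect_le continuous_intros)
    then have "compact ({uL..uR} \<inter> {v. F v - \<xi> * v \<le> F w - \<xi> * w})"
      by (intro compact_Int_closed) auto
    then show ?thesis by (simp add: Int_def)
  qed
  ultimately show ?thesis
    using uL_less_uR by (auto intro!: compact_Inter)
qed

section \<open>The hull function and its secants in terms of contact points\<close>

lemma LconF_le:
  assumes "uL \<le> v" "v \<le> uR"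
  shows "LconF F uL uR v \<le> F v"
proof -
  \<comment> \<open>A minimum of F gives a constant affine minorant, so the supremum is not over the
    empty set.\<close>
  obtain a where "a \<in> contact 0" using contact_nonempty by blast
  then have "\<forall>v\<in>{uL..uR}. 0 * v + F a \<le> F v"
    by (auto simp: contact_def)
  then have "{a * v + b | a b. \<forall>v\<in>{uL..uR}. a * v + b \<le> F v} \<noteq> {}"
    by blast
  then show ?thesis
    unfolding LconF_def by (rule cSup_least) (use assms in auto)
qed

lemma LconF_ge:
  assumes "\<And>w. uL \<le> w \<Longrightarrow> w \<le> uR \<Longrightarrow> a * w + b \<le> F w" "uL \<le> v" "v \<le> uR"
  shows "a * v + b \<le> LconF F uL uR v"
  unfolding LconF_def
proof (rule cSup_upper)
  show "a * v + b \<in> {a * v + b | a b. \<forall>v\<in>{uL..uR}. a * v + b \<le> F v}"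
    using assms(1) by (intro CollectI exI[of _ a] exI[of _ b]) simp
  show "bdd_above {a * v + b | a b. \<forall>v\<in>{uL..uR}. a * v + b \<le> F v}"
    by (rule bdd_aboveI[of _ "F v"]) (use assms in auto)
qed

text \<open>Each affine minorant is below F at both ends, hence below the chord, and this passes to
  the supremum. It replaces convexity of the hull in what follows.\<close>

lemma LconF_le_chord:
  assumes "a < v" "v < b" "uL \<le> a" "b \<le> uR"
  shows "LconF F uL uR v \<le> ((b - v) * F a + (v - a) * F b) / (b - a)"
proof -
  obtain a0 where "a0 \<in> contact 0" using contact_nonempty by blast
  then have "\<forall>v\<in>{uL..uR}. 0 * v + F a0 \<le> F v"
    by (auto simp: contact_def)
  then have ne: "{a * v + b | a b. \<forall>v\<in>{uL..uR}. a * v + b \<le> F v} \<noteq> {}"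
    by blast
  have "k * v + m \<le> ((b - v) * F a + (v - a) * F b) / (b - a)"
    if *: "\<forall>v\<in>{uL..uR}. k * v + m \<le> F v" for k m
  proof -
    have "(b - v) * (k * a + m) \<le> (b - v) * F a" "(v - a) * (k * b + m) \<le> (v - a) * F b"
      using assms * by (auto intro!: mult_left_mono)
    then have "(k * v + m) * (b - a) \<le> (b - v) * F a + (v - a) * F b"
      by (simp add: algebra_simps)
    then show ?thesis using assms by (simp add: field_simps)
  qed
  then show ?thesis
    unfolding LconF_def by (intro cSup_least ne) auto
qed

lemma LconF_contact:
  assumes "v \<in> contact \<sigma>"
  shows "LconF F uL uR v = F v"
proof -
  have "\<sigma> * v + (F v - \<sigma> * v) \<le> LconF F uL uR v"
    by (rule LconF_ge) (use contactD[OF assms] in force)+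
  then show ?thesis
    using LconF_le[of v] contactD[OF assms] by auto
qed

text \<open>If F dipped below the extended secant at some w outside {a..b}, the chord from w to the
  far end would pass below the near end, where the hull meets F. Conversely, the supporting line
  bounds the hull from below and the chord bounds it from above, and they are the same line.\<close>

lemma hull_secant_iff:
  "hull_secant F uL uR a b \<longleftrightarrow> a < b \<and> (\<exists>\<sigma>. a \<in> contact \<sigma> \<and> b \<in> contact \<sigma>)"
proof
  assume h: "hull_secant F uL uR a b"
  define \<sigma> where "\<sigma> = (F b - F a) / (b - a)"
  have ab: "uL \<le> a" "a < b" "b \<le> uR"
    and line: "\<And>v. a \<le> v \<Longrightarrow> v \<le> b \<Longrightarrow> LconF F uL uR v = F a + \<sigma> * (v - a)"
    using h by (auto simp: hull_secant_def \<sigma>_def)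
  have Fb: "F b = F a + \<sigma> * (b - a)"
    using ab by (simp add: \<sigma>_def)
  have above: "F a + \<sigma> * (w - a) \<le> F w" if w: "uL \<le> w" "w \<le> uR" for w
  proof -
    consider "w < a" | "a \<le> w" "w \<le> b" | "b < w" by linarith
    then show ?thesis
    proof cases
      case 1
      have "F a \<le> ((b - a) * F w + (a - w) * F b) / (b - w)"
        using LconF_le_chord[of w a b] line[of a] ab w 1 by simp
      then have "F a * (b - w) \<le> (b - a) * F w + (a - w) * F b"
        using ab 1 by (simp add: pos_le_divide_eq)
      then have "(b - a) * (F a + \<sigma> * (w - a)) \<le> (b - a) * F w"
        by (simp add: Fb algebra_simps)
      then show ?thesis using ab by simp
    next
      case 2
      then show ?thesis using line[of w] LconF_le[of w] w by simp
    next
      case 3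
      have "F b \<le> ((w - b) * F a + (b - a) * F w) / (w - a)"
        using LconF_le_chord[of a b w] line[of b] Fb ab w 3 by simp
      then have "F b * (w - a) \<le> (w - b) * F a + (b - a) * F w"
        using ab 3 by (simp add: pos_le_divide_eq)
      then have "(b - a) * (F a + \<sigma> * (w - a)) \<le> (b - a) * F w"
        by (simp add: Fb algebra_simps)
      then show ?thesis using ab by simp
    qed
  qed
  have "a \<in> contact \<sigma>"
    using ab above by (auto simp: contact_def algebra_simps)
  moreover have "b \<in> contact \<sigma>"
    by (rule contact_transfer[OF \<open>a \<in> contact \<sigma>\<close>]) (use ab Fb in \<open>auto simp: algebra_simps\<close>)
  ultimately show "a < b \<and> (\<exists>\<sigma>. a \<in> contact \<sigma> \<and> b \<in> contact \<sigma>)"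
    using ab by blast
next
  assume "a < b \<and> (\<exists>\<sigma>. a \<in> contact \<sigma> \<and> b \<in> contact \<sigma>)"
  then obtain \<sigma> where ab: "a < b" "a \<in> contact \<sigma>" "b \<in> contact \<sigma>" by blast
  have sl: "(F b - F a) / (b - a) = \<sigma>"
    using contact_slope[OF ab(2,3,1)] by simp
  have "LconF F uL uR v = F a + \<sigma> * (v - a)" if v: "a \<le> v" "v \<le> b" for v
  proof (cases "v = a \<or> v = b")
    case True
    then show ?thesis
      using LconF_contact ab(2,3) contact_eq[OF ab(2,3)] by (auto simp: algebra_simps)
  next
    case False
    have Fb: "F b = F a + \<sigma> * (b - a)"
      using contact_eq[OF ab(2,3)] by (simp add: algebra_simps)
    have "\<sigma> * v + (F a - \<sigma> * a) \<le> LconF F uL uR v"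
      by (rule LconF_ge) (use contactD[OF ab(2)] contactD[OF ab(3)] v in force)+
    moreover have "LconF F uL uR v \<le> ((b - v) * F a + (v - a) * F b) / (b - a)"
      by (rule LconF_le_chord) (use False v contactD[OF ab(2)] contactD[OF ab(3)] in auto)
    moreover have "((b - v) * F a + (v - a) * F b) / (b - a) = F a + \<sigma> * (v - a)"
      using ab(1) unfolding Fb by (simp add: field_simps)
    ultimately show ?thesis by (simp add: algebra_simps)
  qed
  then show "hull_secant F uL uR a b"
    using contactD[OF ab(2)] contactD[OF ab(3)] ab(1) sl by (auto simp: hull_secant_def)
qed

text \<open>The least slope of a supporting line at uR is the largest slope of a chord ending there,
  with \<open>f uR\<close> for the degenerate chord. Some chord is steeper than \<xi> and the
  degenerate one is not, so the maximum is attained at a proper chord.\<close>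

lemma slope_to_right:
  assumes "uL \<le> v" "v \<le> uR" "F v - \<xi> * v < F uR - \<xi> * uR" "f uR \<le> \<xi>"
  obtains \<sigma> a where "\<xi> < \<sigma>" "a < uR" "a \<in> contact \<sigma>" "uR \<in> contact \<sigma>"
proof -
  \<comment> \<open>Caratheodory's form of the derivative: g is the chord slope, continuously
    extended to uR.\<close>
  obtain g where g: "\<And>z. F z - F uR = g z * (z - uR)" "isCont g uR" "g uR = f uR"
    using has_real_derivative_F[of uR] unfolding CARAT_DERIV by blast
  have "isCont g z" if "z \<noteq> uR" for z
  proof -
    have "isCont (\<lambda>z. (F z - F uR) / (z - uR)) z"
      using that has_real_derivative_F DERIV_isCont by (intro continuous_intros) auto
    moreover have "eventually (\<lambda>z. (F z - F uR) / (z - uR) = g z) (nhds z)"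
      using t1_space_nhds[OF that] by eventually_elim (simp add: g(1))
    ultimately show ?thesis
      by (rule isCont_cong[THEN iffD1, rotated])
  qed
  then have "continuous_on {uL..uR} g"
    using g(2) by (metis continuous_at_imp_continuous_on)
  then obtain a where a: "a \<in> {uL..uR}" "\<And>w. w \<in> {uL..uR} \<Longrightarrow> g w \<le> g a"
    using continuous_attains_sup[of "{uL..uR}" g] uL_less_uR by auto
  have "v < uR"
    using assms by (cases "v = uR") auto
  have "(uR - v) * \<xi> < (uR - v) * g v"
    using assms(3) g(1)[of v] by (simp add: algebra_simps)
  then have "\<xi> < g v"
    using \<open>v < uR\<close> by simp
  then have "\<xi> < g a"
    using a(2)[of v] assms by simp
  then have "a \<noteq> uR"
    using g(3) assms(4) by auto
  have "F uR - g a * uR \<le> F w - g a * w" if "w \<in> {uL..uR}" for w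
  proof -
    have "(uR - w) * g w \<le> (uR - w) * g a"
      using a(2)[OF that] that by (intro mult_left_mono) auto
    then show ?thesis
      using g(1)[of w] by (simp add: algebra_simps)
  qed
  then have "uR \<in> contact (g a)"
    using uL_less_uR by (auto simp: contact_def)
  moreover have "a \<in> contact (g a)"
    by (rule contact_transfer[OF \<open>uR \<in> contact (g a)\<close>]) (use a(1) g(1)[of a] in \<open>auto simp: algebra_simps\<close>)
  ultimately show ?thesis
    using that \<open>\<xi> < g a\<close> a(1) \<open>a \<noteq> uR\<close> by (meson atLeastAtMost_iff order_le_imp_less_or_eq)
qed

section \<open>Speeds with more than one contact point\<close>

definition shock_speeds :: "real set" where
  "shock_speeds = {\<xi>. \<exists>a b. a < b \<and> a \<in> contact \<xi> \<and> b \<in> contact \<xi>}"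

lemma contact_unique:
  assumes "\<xi> \<notin> shock_speeds" "a \<in> contact \<xi>" "b \<in> contact \<xi>"
  shows "a = b"
  using assms by (auto simp: shock_speeds_def) (metis linorder_neqE_linordered_idom)

text \<open>By \<open>contact_mono\<close> the open intervals spanned by the contact sets of
  different speeds are disjoint, so a rational from each gives an injection.\<close>

lemma countable_shock_speeds: "countable shock_speeds"
proof -
  have "\<exists>q\<in>\<rat>. \<exists>a b. a < q \<and> q < b \<and> a \<in> contact \<xi> \<and> b \<in> contact \<xi>" if "\<xi> \<in> shock_speeds" for \<xi>
    using that Rats_dense_in_real unfolding shock_speeds_def by blast
  then obtain q where q: "\<And>\<xi>. \<xi> \<in> shock_speeds \<Longrightarrow> q \<xi> \<in> \<rat>"
    "\<And>\<xi>. \<xi> \<in> shock_speeds \<Longrightarrow> \<exists>a b. a < q \<xi> \<and> q \<xi> < b \<and> a \<in> contact \<xi> \<and> b \<in> contact \<xi>"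
    by metis
  have less: "q \<xi> < q \<xi>'" if "\<xi> \<in> shock_speeds" "\<xi>' \<in> shock_speeds" "\<xi> < \<xi>'" for \<xi> \<xi>'
    using q(2)[OF that(1)] q(2)[OF that(2)] contact_mono that(3) by fastforce
  have "inj_on q shock_speeds"
    by (rule inj_onI) (metis less less_irrefl linorder_neqE_linordered_idom)
  moreover have "countable (q ` shock_speeds)"
    by (rule countable_subset[OF _ countable_rat]) (use q in auto)
  ultimately show ?thesis
    using countable_image_inj_on by blast
qed

lemma contact_extremes:
  obtains a b where "a \<in> contact \<xi>" "b \<in> contact \<xi>" "\<And>v. v \<in> contact \<xi> \<Longrightarrow> a \<le> v \<and> v \<le> b"
proof -
  have ne: "contact \<xi> \<noteq> {}" using contact_nonempty by blast
  show ?thesis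
    using compact_attains_inf[OF compact_contact ne] compact_attains_sup[OF compact_contact ne] that
    by metis
qed

text \<open>The extreme contact points of a shock speed span a maximal secant, and the speed is
  recovered as its slope.\<close>

lemma finite_shock_speeds:
  assumes "finite (maximal_hull_secants F uL uR)"
  shows "finite shock_speeds"
proof -
  have "\<xi> \<in> (\<lambda>(a, b). (F b - F a) / (b - a)) ` maximal_hull_secants F uL uR"
    if "\<xi> \<in> shock_speeds" for \<xi>
  proof -
    obtain a b where ab: "a \<in> contact \<xi>" "b \<in> contact \<xi>"
      and ext: "\<And>v. v \<in> contact \<xi> \<Longrightarrow> a \<le> v \<and> v \<le> b"
      using contact_extremes[of \<xi>] by metis
    have "a < b"
      using that ext unfolding shock_speeds_def by (smt (verit) mem_Collect_eq)
    have \<xi>: "\<xi> = (F b - F a) / (b - a)"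
      using contact_slope[OF ab] \<open>a < b\<close> by simp
    have "a' = a \<and> b' = b" if h: "hull_secant F uL uR a' b'" "a' \<le> a" "b \<le> b'" for a' b'
    proof -
      obtain \<sigma> where \<sigma>: "a' \<in> contact \<sigma>" "b' \<in> contact \<sigma>"
        using h by (auto simp: hull_secant_iff)
      have "a \<in> contact \<sigma>" "b \<in> contact \<sigma>"
        using contact_between[OF \<sigma> ab(1)] contact_between[OF \<sigma> ab(2)] \<open>a < b\<close> h by auto
      then have "\<sigma> = \<xi>"
        using contact_slope[of a \<sigma> b] \<open>a < b\<close> \<xi> by simp
      then show ?thesis
        using ext[of a'] ext[of b'] \<sigma> h by auto
    qed
    then have "(a, b) \<in> maximal_hull_secants F uL uR"
      using \<open>a < b\<close> ab by (auto simp: maximal_hull_secants_def hull_secant_iff)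
    then show ?thesis
      using \<xi> by (auto intro!: rev_image_eqI)
  qed
  then show ?thesis
    using assms by (meson finite_imageI finite_subset subsetI)
qed

end

section \<open>The flowed curve and its equal-area arcs\<close>

locale flowed_curve = riemann_problem +
  fixes x0 \<tau> :: real
  assumes \<tau>_pos: "\<tau> > 0"
begin

abbreviation u :: "real \<Rightarrow> real" where "u \<equiv> flow_u uL uR"
abbreviation X :: "real \<Rightarrow> real" where "X \<equiv> flow_x F x0 uL uR \<tau>"
abbreviation EA :: "real \<Rightarrow> real \<Rightarrow> bool" where "EA \<equiv> equal_area F x0 uL uR \<tau>"
abbreviation to_right :: "real \<Rightarrow> bool" where "to_right \<equiv> shock_to_right F x0 uL uR \<tau>"

text \<open>The position of the curve point, rescaled to (x - x0) / \<tau>. A single formula for the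
  three pieces makes continuity across the junctions immediate.\<close>

definition speed :: "real \<Rightarrow> real" where
  "speed p = f (u p) + (min p 0 + max (p - 1) 0) / \<tau>"

lemma u_eq: "u p = uL + (uR - uL) * max 0 (min p 1)"
  by (auto simp: flow_u_def max_def min_def algebra_simps)

lemma X_eq: "X p = x0 + speed p * \<tau>"
  using \<tau>_pos by (auto simp: flow_x_def speed_def flow_u_def max_def min_def field_simps)

lemma u_left [simp]: "p \<le> 0 \<Longrightarrow> u p = uL"
  and u_right [simp]: "1 \<le> p \<Longrightarrow> u p = uR"
  by (auto simp: u_eq max_def min_def algebra_simps)

lemma u_front: "0 \<le> p \<Longrightarrow> p \<le> 1 \<Longrightarrow> u p = uL + (uR - uL) * p"
  by (auto simp: u_eq max_def min_def)

lemma u_mono: "p \<le> q \<Longrightarrow> u p \<le> u q"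
  using uL_less_uR by (auto simp: u_eq intro!: mult_left_mono)

lemma u_bounds: "uL \<le> u p" "u p \<le> uR"
  using u_mono[of "min p 0" p] u_mono[of p "max p 1"] by auto

lemma u_less_iff: "0 \<le> p \<Longrightarrow> q \<le> 1 \<Longrightarrow> u p < u q \<longleftrightarrow> p < q"
  using uL_less_uR u_mono[of q p] by (cases "p < q") (auto simp: u_front)

lemma u_inner_iff: "uL < u p \<and> u p < uR \<longleftrightarrow> 0 < p \<and> p < 1"
  using u_less_iff[of 0 p] u_less_iff[of p 1] uL_less_uR
  by (cases "p \<le> 0"; cases "1 \<le> p") auto

lemma continuous_on_u [continuous_intros]: "continuous_on S u"
  unfolding u_eq[abs_def] by (intro continuous_intros)

lemma continuous_on_f_u [continuous_intros]: "continuous_on S (\<lambda>p. f (u p))"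
  by (rule continuous_on_compose2[OF continuous_on_f continuous_on_u]) auto

lemma continuous_on_F_u [continuous_intros]: "continuous_on S (\<lambda>p. F (u p))"
  by (rule continuous_on_compose2[OF continuous_on_F continuous_on_u]) auto

lemma continuous_on_X [continuous_intros]: "continuous_on S X"
  unfolding X_eq[abs_def] speed_def using \<tau>_pos by (intro continuous_intros) auto

lemma speed_front: "0 \<le> p \<Longrightarrow> p \<le> 1 \<Longrightarrow> speed p = f (u p)"
  by (simp add: speed_def)

lemma speed_left: "p \<le> 0 \<Longrightarrow> speed p = f uL + p / \<tau>"
  by (simp add: speed_def)

lemma speed_right: "1 \<le> p \<Longrightarrow> speed p = f uR + (p - 1) / \<tau>"
  by (simp add: speed_def)

text \<open>Apart from \<open>u p * deriv X p\<close> the product rule leaves u' times (X - x0 -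
  \<tau> f(u)). On the front the second factor vanishes, on the two states the first.\<close>

lemma area_primitive:
  assumes "p \<noteq> 0" "p \<noteq> 1"
  shows "((\<lambda>p. u p * (X p - x0) - \<tau> * F (u p)) has_real_derivative u p * deriv X p) (at p)"
proof -
  obtain u' X' where d: "(u has_real_derivative u') (at p)" "(X has_real_derivative X') (at p)"
    and z: "u' * (X p - x0 - \<tau> * f (u p)) = 0"
  proof -
    consider "p < 0" | "0 < p" "p < 1" | "1 < p" using assms by linarith
    then show ?thesis
    proof cases
      case 1
      have "(u has_real_derivative 0) (at p)"
        by (rule has_field_derivative_transform_within_open[where f = "\<lambda>_. uL" and S = "{..<0}"])
          (use 1 in auto)
      moreover have "(X has_real_derivative 1) (at p)"
        by (rule has_field_derivative_transform_within_open[where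
              f = "\<lambda>p. x0 + p + f uL * \<tau>" and S = "{..<0}"])
          (use 1 in \<open>auto simp: flow_x_def intro!: derivative_eq_intros\<close>)
      ultimately show ?thesis using that by auto
    next
      case 2
      have "(u has_real_derivative (uR - uL)) (at p)"
        by (rule has_field_derivative_transform_within_open[where
              f = "\<lambda>p. uL + (uR - uL) * p" and S = "{0<..<1}"])
          (use 2 in \<open>auto simp: u_front intro!: derivative_eq_intros\<close>)
      moreover from this have "((\<lambda>p. x0 + f (u p) * \<tau>) has_real_derivative
          deriv f (u p) * (uR - uL) * \<tau>) (at p)"
        by (auto intro!: derivative_eq_intros DERIV_chain2[OF has_real_derivative_f])
      then have "(X has_real_derivative deriv f (u p) * (uR - uL) * \<tau>) (at p)"
        by (rule has_field_derivative_transform_within_open[where S = "{0<..<1}"])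
          (use 2 in \<open>auto simp: X_eq speed_front\<close>)
      ultimately show ?thesis
        using that 2 by (auto simp: X_eq speed_front)
    next
      case 3
      have "(u has_real_derivative 0) (at p)"
        by (rule has_field_derivative_transform_within_open[where f = "\<lambda>_. uR" and S = "{1<..}"])
          (use 3 in auto)
      moreover have "(X has_real_derivative 1) (at p)"
        by (rule has_field_derivative_transform_within_open[where
              f = "\<lambda>p. x0 + (p - 1) + f uR * \<tau>" and S = "{1<..}"])
          (use 3 in \<open>auto simp: flow_x_def intro!: derivative_eq_intros\<close>)
      ultimately show ?thesis using that by auto
    qed
  qed
  have "((\<lambda>p. u p * (X p - x0) - \<tau> * F (u p)) has_real_derivative
      u' * (X p - x0) + X' * u p - \<tau> * (f (u p) * u')) (at p)"
    by (auto intro!: derivative_eq_intros d DERIV_chain2[OF has_real_derivative_F])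
  moreover have "u' * (X p - x0) + X' * u p - \<tau> * (f (u p) * u') = u p * deriv X p"
    using DERIV_imp_deriv[OF d(2)] z by (simp add: algebra_simps)
  ultimately show ?thesis by simp
qed

lemma area:
  assumes "p \<le> q"
  shows "((\<lambda>p. u p * deriv X p) has_integral
    (u q * (X q - x0) - \<tau> * F (u q)) - (u p * (X p - x0) - \<tau> * F (u p))) {p..q}"
\<comment> \<open>The primitive is continuous across the junctions, which may therefore be
  exceptional points.\<close>
proof (rule fundamental_theorem_of_calculus_interior_strong[of "{0, 1}"])
  show "continuous_on {p..q} (\<lambda>p. u p * (X p - x0) - \<tau> * F (u p))"
    by (intro continuous_intros)
  show "((\<lambda>p. u p * (X p - x0) - \<tau> * F (u p)) has_vector_derivative u z * deriv X z) (at z)"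
    if "z \<in> {p<..<q} - {0, 1}" for z
    using area_primitive[of z] that by (simp add: has_real_derivative_iff_has_vector_derivative)
qed (use assms in auto)

text \<open>At p the primitive equals -\<tau> times the intercept of the line of slope
  \<open>speed p\<close> through the graph point at height \<open>u p\<close>. Such a line need not
  lie below F, so arcs off the hull occur as well.\<close>

lemma equal_area_iff:
  "EA p q \<longleftrightarrow> p < q \<and> speed p = speed q \<and> F (u p) - speed p * u p = F (u q) - speed p * u q"
proof -
  have "integral {p..q} (\<lambda>p. u p * deriv X p) =
      (u q * (X q - x0) - \<tau> * F (u q)) - (u p * (X p - x0) - \<tau> * F (u p))" if "p < q"
    using area that by (intro integral_unique) simp
  also have "\<dots> = \<tau> * ((F (u p) - speed p * u p) - (F (u q) - speed q * u q))"
    by (simp add: X_eq algebra_simps)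
  finally show ?thesis
    using \<tau>_pos by (auto simp: equal_area_def X_eq)
qed

text \<open>The parameter of the point with height a and speed \<sigma>. An inner height occurs only
  on the front; the height uL fills the whole left state, where
  \<open>f uL + p / \<tau> = \<sigma>\<close> is solved for p. \<open>arc_end\<close> is the mirror
  image.\<close>

definition arc_start :: "real \<Rightarrow> real \<Rightarrow> real" where
  "arc_start \<sigma> a = (if a = uL then (\<sigma> - f uL) * \<tau> else (a - uL) / (uR - uL))"

definition arc_end :: "real \<Rightarrow> real \<Rightarrow> real" where
  "arc_end \<sigma> b = (if b = uR then 1 + (\<sigma> - f uR) * \<tau> else (b - uL) / (uR - uL))"

lemma u_height:
  assumes "uL \<le> v" "v \<le> uR"
  shows "u ((v - uL) / (uR - uL)) = v"
proof -
  have "0 \<le> (v - uL) / (uR - uL)" "(v - uL) / (uR - uL) \<le> 1"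
    using assms uL_less_uR by (auto simp: field_simps)
  then show ?thesis
    using uL_less_uR by (simp add: u_front)
qed

lemma arc_start:
  assumes "a \<in> contact \<sigma>" "a < uR"
  shows "speed (arc_start \<sigma> a) = \<sigma>" "u (arc_start \<sigma> a) = a" "arc_start \<sigma> a < 1"
    "arc_start \<sigma> a \<le> 0 \<longleftrightarrow> a = uL"
proof -
  have *: "speed (arc_start \<sigma> a) = \<sigma> \<and> u (arc_start \<sigma> a) = a \<and> arc_start \<sigma> a < 1 \<and>
      (arc_start \<sigma> a \<le> 0 \<longleftrightarrow> a = uL)"
  proof (cases "a = uL")
    case True
    \<comment> \<open>The one-sided first-order condition at uL puts the solution on the left
      state.\<close>
    have "(\<sigma> - f uL) * \<tau> \<le> 0"
      using contact_slope_le[OF assms] True \<tau>_pos by (intro mult_nonpos_nonneg) auto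
    then show ?thesis
      using True \<tau>_pos by (auto simp: arc_start_def speed_left)
  next
    case False
    then have a: "uL < a" "a < uR"
      using assms by (auto simp: contact_def)
    then have "0 < (a - uL) / (uR - uL)" "(a - uL) / (uR - uL) < 1"
      by auto
    then show ?thesis
      using a False contact_slope_eq[OF assms(1)] u_height[of a]
      by (auto simp: arc_start_def speed_front simp del: divide_le_0_iff)
  qed
  show "speed (arc_start \<sigma> a) = \<sigma>" "u (arc_start \<sigma> a) = a" "arc_start \<sigma> a < 1"
    "arc_start \<sigma> a \<le> 0 \<longleftrightarrow> a = uL"
    using * by auto
qed

lemma arc_end:
  assumes "b \<in> contact \<sigma>" "uL < b"
  shows "speed (arc_end \<sigma> b) = \<sigma>" "u (arc_end \<sigma> b) = b" "0 < arc_end \<sigma> b"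
    "1 \<le> arc_end \<sigma> b \<longleftrightarrow> b = uR"
proof -
  have *: "speed (arc_end \<sigma> b) = \<sigma> \<and> u (arc_end \<sigma> b) = b \<and> 0 < arc_end \<sigma> b \<and>
      (1 \<le> arc_end \<sigma> b \<longleftrightarrow> b = uR)"
  proof (cases "b = uR")
    case True
    have "0 \<le> (\<sigma> - f uR) * \<tau>"
      using contact_slope_ge[OF assms] True \<tau>_pos by (intro mult_nonneg_nonneg) auto
    then show ?thesis
      using True \<tau>_pos by (auto simp: arc_end_def speed_right)
  next
    case False
    then have b: "uL < b" "b < uR"
      using assms by (auto simp: contact_def)
    then have "0 < (b - uL) / (uR - uL)" "(b - uL) / (uR - uL) < 1"
      by auto
    then show ?thesis
      using b False contact_slope_eq[OF assms(1)] u_height[of b]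
      by (auto simp: arc_end_def speed_front simp del: le_divide_eq_1)
  qed
  show "speed (arc_end \<sigma> b) = \<sigma>" "u (arc_end \<sigma> b) = b" "0 < arc_end \<sigma> b"
    "1 \<le> arc_end \<sigma> b \<longleftrightarrow> b = uR"
    using * by auto
qed

lemma equal_area_contact:
  assumes "a \<in> contact \<sigma>" "b \<in> contact \<sigma>" "a < b"
  shows "EA (arc_start \<sigma> a) (arc_end \<sigma> b)"
proof -
  have "a < uR" "uL < b"
    using assms by (auto simp: contact_def)
  note a = arc_start[OF assms(1) this(1)] and b = arc_end[OF assms(2) this(2)]
  have "arc_start \<sigma> a < arc_end \<sigma> b"
    using u_mono[of "arc_end \<sigma> b" "arc_start \<sigma> a"] a b assms(3) by force
  then show ?thesis
    using a b contact_eq[OF assms(1,2)] by (simp add: equal_area_iff)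
qed

lemma to_right_contact:
  assumes "a \<in> contact \<sigma>" "uR \<in> contact \<sigma>" "a < uR"
  shows "to_right (arc_start \<sigma> a)"
  unfolding shock_to_right_def
  using arc_start[OF assms(1,3)] arc_end[OF assms(2) uL_less_uR] equal_area_contact[OF assms(1,2,3)]
  by auto

text \<open>Were uR not a contact point at the selected speed, \<open>slope_to_right\<close> would
  give a faster shock to uR. Equal intercepts then carry contact from uR to the start of the
  arc.\<close>

lemma selected_contact:
  assumes "selected_shock_to_right F x0 uL uR \<tau> p"
  shows "u p \<in> contact (speed p)" "uR \<in> contact (speed p)" "u p < uR" "p < 1"
proof -
  from assms have "to_right p" and max: "\<And>q. to_right q \<Longrightarrow> speed q \<le> speed p"
    using \<tau>_pos by (auto simp: selected_shock_to_right_def X_eq)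
  then obtain q where q: "p < 1" "1 \<le> q" "EA p q"
    by (auto simp: shock_to_right_def)
  then have "f uR \<le> speed p"
    using speed_right[of q] \<tau>_pos by (auto simp: equal_area_iff)
  have uR: "uR \<in> contact (speed p)"
  proof (rule ccontr)
    assume "uR \<notin> contact (speed p)"
    then obtain v where "uL \<le> v" "v \<le> uR" "F v - speed p * v < F uR - speed p * uR"
      using uL_less_uR by (auto simp: contact_def not_le)
    then obtain \<sigma> a where \<sigma>: "speed p < \<sigma>" "a < uR" "a \<in> contact \<sigma>" "uR \<in> contact \<sigma>"
      using slope_to_right[OF _ _ _ \<open>f uR \<le> speed p\<close>] by metis
    have "speed (arc_start \<sigma> a) \<le> speed p"
      using max to_right_contact \<sigma> by blast
    then show False
      using arc_start \<sigma> by simp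
  qed
  show "u p \<in> contact (speed p)"
    by (rule contact_transfer[OF uR]) (use q u_bounds in \<open>auto simp: equal_area_iff\<close>)
  show "u p < uR"
    using u_less_iff[of "max p 0" 1] q uL_less_uR by (cases "p \<le> 0") (auto simp: max_def)
  show "uR \<in> contact (speed p)" "p < 1"
    using uR q by auto
qed

lemma no_shock_contact:
  assumes "\<nexists>p. to_right p"
  shows "uR \<in> contact (f uR)"
proof (rule ccontr)
  assume "uR \<notin> contact (f uR)"
  then obtain v where "uL \<le> v" "v \<le> uR" "F v - f uR * v < F uR - f uR * uR"
    using uL_less_uR by (auto simp: contact_def not_le)
  then show False
    using slope_to_right[of v "f uR"] to_right_contact assms by (metis order_refl)
qed

text \<open>
  The parameters from which step (3) may be started. For \<open>s = 1\<close> a supporting line at \<open>uR\<close> need not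
  have slope \<open>f uR\<close>, hence the extra condition.
\<close>

definition ready :: "real \<Rightarrow> bool" where
  "ready s \<longleftrightarrow> 0 < s \<and> s \<le> 1 \<and> u s \<in> contact (speed s) \<and> (s = 1 \<longrightarrow> (\<nexists>p. to_right p))"

text \<open>A secant strictly over an inner height would yield an arc ending in the part of the
  front above t. Of t only the upper bound property is assumed, so the lemma also serves with t = 0
  when there is no end at all, and for the supremum of the ends before it is known to be
  attained.\<close>

lemma contact_above_front_ends:
  assumes "ready s" "0 \<le> t" "t \<le> p" "p \<le> s"
    and "\<And>t'. front_end F x0 uL uR \<tau> s t' \<Longrightarrow> t' \<le> t"
  shows "u p \<in> contact (speed p)"
proof -
  have s: "0 < s" "s \<le> 1" "u s \<in> contact (speed s)" "s = 1 \<Longrightarrow> \<nexists>p. to_right p"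
    using assms(1) by (auto simp: ready_def)
  have inner: "u q \<in> contact (speed q)" if q: "t < q" "q < s" for q
  proof -
    have uq: "uL < u q" "u q < uR" "u q < u s"
      using u_inner_iff[of q] u_less_iff[of q s] q assms(2) s(1,2) by auto
    obtain \<sigma> a b where ab: "a \<in> contact \<sigma>" "b \<in> contact \<sigma>" "a \<le> u q" "u q \<le> b"
      by (rule contact_straddle[OF u_bounds])
    show ?thesis
    proof (cases "u q \<in> contact \<sigma>")
      case True
      then show ?thesis
        using contact_slope_eq[OF True] uq speed_front[of q] q s assms(2) by simp
    next
      case False
      with ab have "a < u q" "u q < b" by (metis order_le_less)+
      \<comment> \<open>The secant may overshoot s. As \<open>u s\<close> is itself a contact point,
        the secant can be cut there.\<close>
      define c where "c = min b (u s)"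
      have c: "c \<in> contact \<sigma>" "u q < c" "c \<le> u s"
        using contact_between[OF ab(1,2) s(3)] ab(2) \<open>a < u q\<close> \<open>u q < b\<close> uq(3)
        by (auto simp: c_def min_def)
      have "uL < c" using c uq by simp
      note e = arc_end[OF c(1) this]
      have ea: "EA (arc_start \<sigma> a) (arc_end \<sigma> c)"
        using equal_area_contact[OF ab(1) c(1)] \<open>a < u q\<close> c(2) by simp
      show ?thesis
      proof (cases "c = uR")
        case True
        have "u s = uR" using c(3) True u_bounds[of s] by simp
        then have "s = 1" using u_inner_iff[of s] s(1,2) u_less_iff[of s 1] by force
        moreover have "to_right (arc_start \<sigma> a)"
          using to_right_contact ab(1) c(1) True \<open>a < u q\<close> uq by simp
        ultimately show ?thesis using s(4) by blast
      next
        case False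
        then have lt: "arc_end \<sigma> c < 1" using e by simp
        have "arc_end \<sigma> c \<le> s"
          using u_less_iff[of s "arc_end \<sigma> c"] e c lt s(1,2) by force
        then have "arc_end \<sigma> c \<le> t"
          using assms(5) ea e by (auto simp: front_end_def)
        then have "u (arc_end \<sigma> c) \<le> u q"
          using q by (intro u_mono) simp
        then show ?thesis
          using e c by simp
      qed
    qed
  qed
  \<comment> \<open>An arc may end at t, so the argument above does not reach t; each contact
    inequality is closed and passes to the limit from the right.\<close>
  have closed: "u q \<in> contact (speed q)" if "q = t" "t < s" for q
  proof -
    have "F (u t) - f (u t) * u t \<le> F w - f (u t) * w" if w: "uL \<le> w" "w \<le> uR" for w
    proof -
      have "closed {q. F (u q) - f (u q) * u q \<le> F w - f (u q) * w}"
        by (intro closed_Collect_le continuous_intros)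
      moreover have "{t<..<s} \<subseteq> {q. F (u q) - f (u q) * u q \<le> F w - f (u q) * w}"
        using inner speed_front assms(2) s(2) w by (force simp: contact_def)
      ultimately have "closure {t<..<s} \<subseteq> {q. F (u q) - f (u q) * u q \<le> F w - f (u q) * w}"
        by (rule closure_minimal[rotated])
      moreover have "t \<in> closure {t<..<s}"
        using \<open>t < s\<close> by simp
      ultimately show ?thesis by blast
    qed
    then show ?thesis
      using that u_bounds[of t] speed_front[of t] assms(2) s(2) by (auto simp: contact_def)
  qed
  consider "p = s" | "t < p" "p < s" | "p = t" "t < s"
    using assms(3,4) by linarith
  then show ?thesis
    by cases (use s inner closed in auto)
qed

lemma largest_front_end_contact:
  assumes "ready s" "largest_front_end F x0 uL uR \<tau> s t"
  shows "0 < t" "t < 1" "t \<le> s" "\<And>p. t \<le> p \<Longrightarrow> p \<le> s \<Longrightarrow> u p \<in> contact (speed p)"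
    "\<And>p q. EA q p \<Longrightarrow> 0 < p \<Longrightarrow> p \<le> s \<Longrightarrow> p \<le> t"
    "\<And>q. EA q t \<Longrightarrow> q < t \<and> speed q = f (u t) \<and> u q \<in> contact (f (u t)) \<and> u q < u t"
proof -
  from assms(2) obtain p0 where t: "0 < t" "t \<le> s" "EA p0 t"
    and largest: "\<And>t'. front_end F x0 uL uR \<tau> s t' \<Longrightarrow> t' \<le> t"
    by (auto simp: largest_front_end_def front_end_def)
  \<comment> \<open>Parameter 1 belongs to the front and to the right state, so an arc ending there
    counts as a shock to uR, which \<open>ready\<close> excludes for s = 1.\<close>
  have "t \<noteq> 1"
  proof
    assume "t = 1"
    then have "s = 1" "to_right p0"
      using t assms(1) by (auto simp: ready_def shock_to_right_def equal_area_iff)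
    then show False using assms(1) by (auto simp: ready_def)
  qed
  then show "0 < t" "t < 1" "t \<le> s"
    using t assms(1) by (auto simp: ready_def)
  show contact: "u p \<in> contact (speed p)" if "t \<le> p" "p \<le> s" for p
    using contact_above_front_ends[OF assms(1) _ that largest] t(1) by simp
  show "p \<le> t" if "EA q p" "0 < p" "p \<le> s" for p q
    using largest that by (auto simp: front_end_def)
  show "q < t \<and> speed q = f (u t) \<and> u q \<in> contact (f (u t)) \<and> u q < u t" if "EA q t" for q
  proof -
    have q: "q < t" "speed q = f (u t)" "F (u q) - f (u t) * u q = F (u t) - f (u t) * u t"
      using that t \<open>t < 1\<close> speed_front[of t] by (auto simp: equal_area_iff)
    moreover have "u q \<in> contact (f (u t))"
      by (rule contact_transfer[of "u t"])
        (use contact[of t] t \<open>t < 1\<close> speed_front[of t] q u_bounds in auto)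
    moreover have "u q < u t"
      using u_less_iff[of "max q 0" t] q t \<open>t < 1\<close> by (cases "q \<le> 0") (auto simp: max_def)
    ultimately show ?thesis by blast
  qed
qed

section \<open>The algorithm follows the hull\<close>

text \<open>Turning the line about its left end to a smaller slope lowers it on the whole interval.
  Hence the left state may be kept beyond its shock.\<close>

lemma contact_uL_antimono:
  assumes "uL \<in> contact \<xi>" "\<zeta> \<le> \<xi>"
  shows "uL \<in> contact \<zeta>"
proof -
  have "F uL - \<zeta> * uL \<le> F w - \<zeta> * w" if "uL \<le> w" "w \<le> uR" for w
  proof -
    have "\<zeta> * (w - uL) \<le> \<xi> * (w - uL)"
      using assms that by (intro mult_right_mono) auto
    then show ?thesis
      using contactD(3)[OF assms(1) that] by (simp add: algebra_simps)
  qed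
  then show ?thesis
    using uL_less_uR by (auto simp: contact_def)
qed

lemma contact_uR_mono:
  assumes "uR \<in> contact \<xi>" "\<xi> \<le> \<zeta>"
  shows "uR \<in> contact \<zeta>"
proof -
  have "F uR - \<zeta> * uR \<le> F w - \<zeta> * w" if "uL \<le> w" "w \<le> uR" for w
  proof -
    have "\<xi> * (uR - w) \<le> \<zeta> * (uR - w)"
      using assms that by (intro mult_right_mono) auto
    then show ?thesis
      using contactD(3)[OF assms(1) that] by (simp add: algebra_simps)
  qed
  then show ?thesis
    using uL_less_uR by (auto simp: contact_def)
qed

definition shocks_on_hull :: "(real \<times> real \<times> real) set \<Rightarrow> bool" where
  "shocks_on_hull V \<longleftrightarrow>
     (\<forall>y a b. (y, a, b) \<in> V \<longrightarrow> (\<exists>\<xi>. y = x0 + \<xi> * \<tau> \<and> a < b \<and> a \<in> contact \<xi> \<and> b \<in> contact \<xi>))"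

text \<open>With the first clause \<open>contact_mono\<close> shows that uR was not a contact point
  at the speed of a point cut off. The second clause gives single-valuedness for arcs that end on
  the right state: their position carries a vertical line.\<close>

definition right_resolved :: "real set \<Rightarrow> (real \<times> real \<times> real) set \<Rightarrow> bool" where
  "right_resolved K V \<longleftrightarrow>
     (\<forall>p\<ge>1. p \<in> K \<or> (\<exists>\<xi> a. (x0 + \<xi> * \<tau>, a, uR) \<in> V \<and> speed p < \<xi>)) \<and>
     (\<forall>\<xi> a. a < uR \<and> a \<in> contact \<xi> \<and> uR \<in> contact \<xi> \<longrightarrow> (\<exists>c d. (x0 + \<xi> * \<tau>, c, d) \<in> V))"

text \<open>There is no second clause here: of two different heights at one position, the upper one
  is never on the left state.\<close>

definition left_resolved :: "real set \<Rightarrow> (real \<times> real \<times> real) set \<Rightarrow> bool" where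
  "left_resolved K V \<longleftrightarrow> (\<forall>p\<le>0. p \<in> K \<or> (\<exists>\<xi> b. (x0 + \<xi> * \<tau>, uL, b) \<in> V \<and> \<xi> < speed p))"

definition front_point_resolved :: "real set \<Rightarrow> (real \<times> real \<times> real) set \<Rightarrow> real \<Rightarrow> bool" where
  "front_point_resolved K V p \<longleftrightarrow> p \<in> K \<or> (\<exists>y a b. (y, a, b) \<in> V \<and> a \<le> u p \<and> u p \<le> b)"

text \<open>The clause on arcs makes the remaining curve single-valued. It concerns final ends
  inside the front; those on the right state are left to \<open>right_resolved\<close>.\<close>

definition kept_on_hull :: "real \<Rightarrow> bool" where
  "kept_on_hull p \<longleftrightarrow> u p \<in> contact (speed p) \<and> (0 < p \<and> p < 1 \<longrightarrow> (\<nexists>q. EA q p))"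

text \<open>
  The loop invariant: the algorithm still has to treat the parameters below \<open>s\<close>, all of which are kept.
\<close>

definition resolved_above :: "real \<Rightarrow> real set \<Rightarrow> (real \<times> real \<times> real) set \<Rightarrow> bool" where
  "resolved_above s K V \<longleftrightarrow> shocks_on_hull V \<and> right_resolved K V \<and>
     (\<forall>p<s. p \<in> K) \<and> (\<forall>p\<in>K. s \<le> p \<longrightarrow> kept_on_hull p) \<and>
     (\<forall>p. s \<le> p \<and> p < 1 \<longrightarrow> front_point_resolved K V p)"

definition resolved :: "real set \<Rightarrow> (real \<times> real \<times> real) set \<Rightarrow> bool" where
  "resolved K V \<longleftrightarrow> shocks_on_hull V \<and> right_resolved K V \<and> left_resolved K V \<and>
     (\<forall>p\<in>K. kept_on_hull p) \<and> (\<forall>p. 0 < p \<and> p < 1 \<longrightarrow> front_point_resolved K V p)"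

lemma shocks_on_hull_insert:
  assumes "shocks_on_hull V" "a < b" "a \<in> contact \<xi>" "b \<in> contact \<xi>"
  shows "shocks_on_hull (insert (x0 + \<xi> * \<tau>, a, b) V)"
  using assms unfolding shocks_on_hull_def by blast

lemma right_resolved_mono:
  assumes "right_resolved K V" "\<And>p. 1 \<le> p \<Longrightarrow> p \<in> K \<Longrightarrow> p \<in> K'" "V \<subseteq> V'"
  shows "right_resolved K' V'"
  using assms unfolding right_resolved_def by (meson subsetD)

lemma front_point_resolved_mono:
  assumes "front_point_resolved K V p" "p \<in> K \<Longrightarrow> p \<in> K'" "V \<subseteq> V'"
  shows "front_point_resolved K' V' p"
  using assms unfolding front_point_resolved_def by blast

lemma front_point_resolved_insert:
  assumes "a \<le> u p" "u p \<le> b"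
  shows "front_point_resolved K (insert (y, a, b) V) p"
  using assms unfolding front_point_resolved_def by blast

lemma kept_on_hull_left:
  assumes "uL \<in> contact \<xi>" "p \<le> 0" "speed p \<le> \<xi>"
  shows "kept_on_hull p"
  using assms contact_uL_antimono by (auto simp: kept_on_hull_def)

lemma kept_on_hull_right:
  assumes "uR \<in> contact \<xi>" "1 \<le> p" "\<xi> \<le> speed p"
  shows "kept_on_hull p"
  using assms contact_uR_mono by (auto simp: kept_on_hull_def)

lemma geap_front_resolved:
  assumes "geap_front F x0 uL uR \<tau> s C D" "ready s" "resolved_above s (fst C) (snd C)"
  shows "resolved (fst D) (snd D)"
  using assms
proof (induction rule: geap_front.induct)
  case (stop s C)
  \<comment> \<open>No arc ends on the remaining front, so 0 bounds the ends vacuously.\<close>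
  have contact: "u p \<in> contact (speed p)" if "0 \<le> p" "p \<le> s" for p
    using contact_above_front_ends[OF stop(2), of 0] that stop(1) by blast
  have no_end: "\<nexists>q. EA q p" if "0 < p" "p \<le> s" for p
    using stop(1) that by (auto simp: front_end_def)
  have s: "0 < s" "s \<le> 1"
    using stop(2) by (auto simp: ready_def)
  have uL: "uL \<in> contact (f uL)"
    using contact[of 0] s by (simp add: speed_front)
  have "kept_on_hull p" if "p < s" for p
  proof (cases "p \<le> 0")
    case True
    then show ?thesis
      using \<tau>_pos by (intro kept_on_hull_left[OF uL]) (auto simp: speed_left divide_nonpos_pos)
  next
    case False
    then show ?thesis
      using contact[of p] no_end[of p] that by (auto simp: kept_on_hull_def)
  qed
  moreover have "left_resolved (fst C) (snd C)"
    using stop(3) s by (auto simp: left_resolved_def resolved_above_def)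
  ultimately show ?case
    using stop(3) unfolding resolved_def resolved_above_def
    by (metis front_point_resolved_def not_le)
next
  case (to_left s t p0 K V)
  note t = largest_front_end_contact[OF to_left(4,1)]
  define \<xi> where "\<xi> = f (u t)"
  have inv: "shocks_on_hull V" "right_resolved K V" "\<And>p. p < s \<Longrightarrow> p \<in> K"
    "\<And>p. p \<in> K \<Longrightarrow> s \<le> p \<Longrightarrow> kept_on_hull p"
    "\<And>p. s \<le> p \<Longrightarrow> p < 1 \<Longrightarrow> front_point_resolved K V p"
    using to_left(5) by (auto simp: resolved_above_def)
  have uL: "uL \<in> contact \<xi>" "uL < u t"
    using t(6)[OF to_left(3)] to_left(2) by (auto simp: \<xi>_def)
  have ut: "u t \<in> contact \<xi>"
    using t(4)[of t] t(1-3) speed_front[of t] by (simp add: \<xi>_def)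
  have "\<xi> \<le> f uL"
    using contact_slope_le[OF uL(1) uL_less_uR] .
  define \<rho> where "\<rho> = (f uL - \<xi>) * \<tau>"
  have "0 \<le> \<rho>"
    using \<open>\<xi> \<le> f uL\<close> \<tau>_pos by (simp add: \<rho>_def)
  \<comment> \<open>The points removed from the left state are those that have run ahead of the
    shock.\<close>
  have \<rho>: "- \<rho> < p \<longleftrightarrow> \<xi> < speed p" if "p \<le> 0" for p
    using that \<tau>_pos by (simp add: \<rho>_def speed_left field_simps)
  let ?K = "K - {- \<rho> <.. t}" and ?V = "insert (x0 + \<xi> * \<tau>, uL, u t) V"
  have "shocks_on_hull ?V"
    by (rule shocks_on_hull_insert[OF inv(1) uL(2,1) ut])
  moreover have "right_resolved ?K ?V"
    by (rule right_resolved_mono[OF inv(2)]) (use t(2) in auto)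
  moreover have "left_resolved ?K ?V"
    unfolding left_resolved_def
  proof (intro allI impI)
    fix p :: real assume "p \<le> 0"
    then have "p \<in> K"
      using inv(3)[of p] t(1,3) by simp
    then show "p \<in> ?K \<or> (\<exists>\<xi>' b. (x0 + \<xi>' * \<tau>, uL, b) \<in> ?V \<and> \<xi>' < speed p)"
      using \<rho>[OF \<open>p \<le> 0\<close>] by auto
  qed
  moreover have "kept_on_hull p" if p: "p \<in> ?K" for p
  proof -
    consider "p \<le> - \<rho>" | "t < p" "p < s" | "s \<le> p"
      using p by force
    then show ?thesis
    proof cases
      case 1
      then show ?thesis
        using \<rho>[of p] \<open>0 \<le> \<rho>\<close> by (intro kept_on_hull_left[OF uL(1)]) auto
    next
      case 2
      then show ?thesis
        using t(4)[of p] t(5)[of _ p] t(1) by (force simp: kept_on_hull_def)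
    qed (use inv(4) p in auto)
  qed
  moreover have "front_point_resolved ?K ?V p" if p: "0 < p" "p < 1" for p
  proof -
    consider "p \<le> t" | "t < p" "p < s" | "s \<le> p" by linarith
    then show ?thesis
    proof cases
      case 1
      then show ?thesis
        using u_bounds u_mono by (intro front_point_resolved_insert) auto
    next
      case 2
      then show ?thesis
        using inv(3) by (simp add: front_point_resolved_def)
    next
      case 3
      then show ?thesis
      \<comment> \<open>If t = s, this point may so far have been resolved by being kept; it is
        removed now and the new line covers it.\<close>
      proof (cases "p = t")
        case False
        with 3 show ?thesis
          using t(3) p by (intro front_point_resolved_mono[OF inv(5)]) auto
      qed (auto intro!: front_point_resolved_insert u_bounds)
    qed
  qed
  ultimately show ?case
    by (simp add: resolved_def \<xi>_def \<rho>_def)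
next
  case (inner s t s' K V D)
  note t = largest_front_end_contact[OF inner(6,1)]
  define \<xi> where "\<xi> = f (u t)"
  have inv: "shocks_on_hull V" "right_resolved K V" "\<And>p. p < s \<Longrightarrow> p \<in> K"
    "\<And>p. p \<in> K \<Longrightarrow> s \<le> p \<Longrightarrow> kept_on_hull p"
    "\<And>p. s \<le> p \<Longrightarrow> p < 1 \<Longrightarrow> front_point_resolved K V p"
    using inner(7) by (auto simp: resolved_above_def)
  have s': "s' < t" "speed s' = \<xi>" "u s' \<in> contact \<xi>" "u s' < u t"
    using t(6)[OF inner(3)] by (auto simp: \<xi>_def)
  have ut: "u t \<in> contact \<xi>"
    using t(4)[of t] t(1-3) speed_front[of t] by (simp add: \<xi>_def)
  \<comment> \<open>Since s' < t < 1, the clause for s = 1 is vacuous from here on.\<close>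
  have "ready s'"
    using s' t(2) inner(2) by (simp add: ready_def)
  let ?K = "K - {s'..t}" and ?V = "insert (x0 + \<xi> * \<tau>, u s', u t) V"
  have "shocks_on_hull ?V"
    by (rule shocks_on_hull_insert[OF inv(1) s'(4,3) ut])
  moreover have "right_resolved ?K ?V"
    by (rule right_resolved_mono[OF inv(2)]) (use t(2) in auto)
  moreover have "p \<in> ?K" if "p < s'" for p
    using that inv(3)[of p] s' t(3) by simp
  moreover have "kept_on_hull p" if p: "p \<in> ?K" "s' \<le> p" for p
  proof -
    consider "t < p" "p < s" | "s \<le> p"
      using p by force
    then show ?thesis
    proof cases
      case 1
      then show ?thesis
        using t(4)[of p] t(5)[of _ p] t(1) by (force simp: kept_on_hull_def)
    qed (use inv(4) p in auto)
  qed
  moreover have "front_point_resolved ?K ?V p" if p: "s' \<le> p" "p < 1" for p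
  proof -
    consider "p \<le> t" | "t < p" "p < s" | "s \<le> p" "t < p" by linarith
    then show ?thesis
    proof cases
      case 1
      then show ?thesis
        using p u_mono by (intro front_point_resolved_insert) auto
    next
      case 2
      then show ?thesis
        using inv(3) by (simp add: front_point_resolved_def)
    next
      case 3
      then show ?thesis
        using p by (intro front_point_resolved_mono[OF inv(5)]) auto
    qed
  qed
  ultimately have "resolved_above s' ?K ?V"
    by (simp add: resolved_above_def)
  then show ?case
    using inner.IH \<open>ready s'\<close> by (simp add: \<xi>_def)
qed

text \<open>Otherwise uR would touch at the smaller slope and a point below uR at the larger one,
  against \<open>contact_mono\<close>. So one inserted line satisfies the second clause of
  \<open>right_resolved\<close>.\<close>

lemma contact_uR_unique:
  assumes "uR \<in> contact \<xi>" "a \<in> contact \<xi>" "a < uR" "uR \<in> contact \<zeta>" "b \<in> contact \<zeta>" "b < uR"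
  shows "\<xi> = \<zeta>"
  using contact_mono[OF assms(1,5)] contact_mono[OF assms(4,2)] assms(3,6) by force

lemma right_resolved_shock:
  assumes "uR \<in> contact \<xi>" "a \<in> contact \<xi>" "a < uR"
    and "\<And>p. 1 \<le> p \<Longrightarrow> \<xi> \<le> speed p \<Longrightarrow> p \<in> K"
  shows "right_resolved K {(x0 + \<xi> * \<tau>, a, uR)}"
  unfolding right_resolved_def
proof (intro conjI allI impI)
  show "p \<in> K \<or> (\<exists>\<zeta> c. (x0 + \<zeta> * \<tau>, c, uR) \<in> {(x0 + \<xi> * \<tau>, a, uR)} \<and> speed p < \<zeta>)"
    if "1 \<le> p" for p
    using assms(4)[OF that] by (metis insertI1 not_le)
  show "\<exists>c d. (x0 + \<zeta> * \<tau>, c, d) \<in> {(x0 + \<xi> * \<tau>, a, uR)}"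
    if "b < uR \<and> b \<in> contact \<zeta> \<and> uR \<in> contact \<zeta>" for \<zeta> b
    using contact_uR_unique[OF assms(1-3)] that by blast
qed

lemma geap_resolved:
  assumes "geap F x0 uL uR \<tau> C"
  shows "resolved (fst C) (snd C)"
  using assms
proof cases
  case (whole p \<sigma>)
  have c: "uL \<in> contact (speed p)" "uR \<in> contact (speed p)"
    using selected_contact[OF whole(2)] whole(3) by auto
  \<comment> \<open>The algorithm prescribes the Rankine-Hugoniot speed; it agrees with the position
    of the arc because both ends touch the same supporting line.\<close>
  have \<sigma>: "\<sigma> = speed p"
    using contact_slope[OF c uL_less_uR] whole(4) by (simp add: minus_divide_divide[symmetric, of "F uL - F uR"])
  have c: "uL \<in> contact \<sigma>" "uR \<in> contact \<sigma>"
    using c \<sigma> by auto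
  have le: "\<sigma> \<le> f uL" "f uR \<le> \<sigma>"
    using contact_slope_le[OF c(1) uL_less_uR] contact_slope_ge[OF c(2) uL_less_uR] .
  define \<rho> where "\<rho> = (f uL - \<sigma>) * \<tau>"
  define \<kappa> where "\<kappa> = (\<sigma> - f uR) * \<tau>"
  have "0 \<le> \<rho>" "0 \<le> \<kappa>"
    using le \<tau>_pos by (auto simp: \<rho>_def \<kappa>_def)
  have \<rho>: "- \<rho> < p \<longleftrightarrow> \<sigma> < speed p" if "p \<le> 0" for p
    using that \<tau>_pos by (simp add: \<rho>_def speed_left field_simps)
  have \<kappa>: "p < 1 + \<kappa> \<longleftrightarrow> speed p < \<sigma>" if "1 \<le> p" for p
    using that \<tau>_pos by (simp add: \<kappa>_def speed_right field_simps)
  let ?K = "UNIV - {- \<rho> <..< 1 + \<kappa>}" and ?V = "{(x0 + \<sigma> * \<tau>, uL, uR)}"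
  have "shocks_on_hull ?V"
    using c uL_less_uR by (auto simp: shocks_on_hull_def)
  moreover have "right_resolved ?K ?V"
    by (rule right_resolved_shock[OF c(2,1) uL_less_uR]) (use \<kappa> in force)
  moreover have "left_resolved ?K ?V"
    unfolding left_resolved_def
  proof (intro allI impI)
    fix p :: real assume "p \<le> 0"
    show "p \<in> ?K \<or> (\<exists>\<xi>' b. (x0 + \<xi>' * \<tau>, uL, b) \<in> ?V \<and> \<xi>' < speed p)"
      using \<rho>[OF \<open>p \<le> 0\<close>] by auto
  qed
  moreover have "kept_on_hull p" if p: "p \<in> ?K" for p
  proof (cases "p \<le> - \<rho>")
    case True
    then show ?thesis
      using \<rho>[of p] \<open>0 \<le> \<rho>\<close> by (intro kept_on_hull_left[OF c(1)]) auto
  next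
    case False
    then show ?thesis
      using \<kappa>[of p] \<open>0 \<le> \<kappa>\<close> p by (intro kept_on_hull_right[OF c(2)]) auto
  qed
  moreover have "front_point_resolved ?K ?V p" for p
    by (intro front_point_resolved_insert u_bounds)
  ultimately show ?thesis
    unfolding whole(1) by (simp add: resolved_def \<rho>_def \<kappa>_def)
next
  case (to_right s)
  define \<xi> where "\<xi> = f (u s)"
  have s: "u s \<in> contact \<xi>" "uR \<in> contact \<xi>" "u s < uR" "s < 1" "speed s = \<xi>"
    using selected_contact[OF to_right(1)] to_right(2) speed_front[of s] by (auto simp: \<xi>_def)
  have "ready s"
    using s to_right(2) by (auto simp: ready_def)
  have le: "f uR \<le> \<xi>"
    using contact_slope_ge[OF s(2) uL_less_uR] .
  define \<kappa> where "\<kappa> = (\<xi> - f uR) * \<tau>"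
  have "0 \<le> \<kappa>"
    using le \<tau>_pos by (auto simp: \<kappa>_def)
  have \<kappa>: "p < 1 + \<kappa> \<longleftrightarrow> speed p < \<xi>" if "1 \<le> p" for p
    using that \<tau>_pos by (simp add: \<kappa>_def speed_right field_simps)
  let ?K = "UNIV - {s ..< 1 + \<kappa>}" and ?V = "{(x0 + \<xi> * \<tau>, u s, uR)}"
  have "shocks_on_hull ?V"
    using s by (auto simp: shocks_on_hull_def)
  moreover have "right_resolved ?K ?V"
    by (rule right_resolved_shock[OF s(2,1,3)]) (use \<kappa> in force)
  moreover have "kept_on_hull p" if p: "p \<in> ?K" "s \<le> p" for p
    using \<kappa>[of p] \<open>0 \<le> \<kappa>\<close> p by (intro kept_on_hull_right[OF s(2)]) auto
  moreover have "front_point_resolved ?K ?V p" if "s \<le> p" for p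
    by (intro front_point_resolved_insert u_bounds u_mono that)
  ultimately have "resolved_above s ?K ?V"
    by (simp add: resolved_above_def)
  then show ?thesis
    using geap_front_resolved[OF to_right(3) \<open>ready s\<close>] by (simp add: \<xi>_def \<kappa>_def)
next
  case no_shock
  have uR: "uR \<in> contact (f uR)"
    by (rule no_shock_contact) (use no_shock in simp)
  then have "ready 1"
    using no_shock by (simp add: ready_def speed_right)
  have "right_resolved UNIV {}"
    using to_right_contact no_shock(1) unfolding right_resolved_def by blast
  moreover have "kept_on_hull p" if "1 \<le> p" for p
    using that \<tau>_pos by (intro kept_on_hull_right[OF uR]) (auto simp: speed_right)
  ultimately have "resolved_above 1 UNIV {}"
    by (auto simp: resolved_above_def shocks_on_hull_def)
  then show ?thesis
    using geap_front_resolved[OF no_shock(2) \<open>ready 1\<close>] by simp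
qed

section \<open>Points of the generated curve over a given position\<close>

abbreviation points :: "shock_curve \<Rightarrow> (real \<times> real) set" where
  "points \<equiv> curve_points F x0 uL uR \<tau>"

lemma kept_point: "p \<in> K \<Longrightarrow> (x0 + speed p * \<tau>, u p) \<in> points (K, V)"
  by (auto simp: curve_points_def X_eq)

lemma shock_point: "(y, a, b) \<in> V \<Longrightarrow> a \<le> h \<Longrightarrow> h \<le> b \<Longrightarrow> (y, h) \<in> points (K, V)"
  by (auto simp: curve_points_def)

lemma resolved_point:
  assumes "resolved K V" "(x0 + \<xi> * \<tau>, h) \<in> points (K, V)"
  obtains p where "p \<in> K" "speed p = \<xi>" "u p = h" "h \<in> contact \<xi>"
  | a b where "(x0 + \<xi> * \<tau>, a, b) \<in> V" "a \<le> h" "h \<le> b" "a < b" "a \<in> contact \<xi>" "b \<in> contact \<xi>"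
proof -
  consider p where "p \<in> K" "X p = x0 + \<xi> * \<tau>" "u p = h"
    | a b where "(x0 + \<xi> * \<tau>, a, b) \<in> V" "a \<le> h" "h \<le> b"
    using assms(2) by (auto simp: curve_points_def)
  then show ?thesis
  proof cases
    case 1
    then have "speed p = \<xi>"
      using \<tau>_pos by (simp add: X_eq)
    with 1 show ?thesis
      using assms(1) that(1)[of p] by (auto simp: resolved_def kept_on_hull_def)
  next
    case 2
    then obtain \<zeta> where "x0 + \<xi> * \<tau> = x0 + \<zeta> * \<tau>" "a < b" "a \<in> contact \<zeta>" "b \<in> contact \<zeta>"
      using assms(1) unfolding resolved_def shocks_on_hull_def by blast
    then show ?thesis
      using 2 that(2)[of a b] \<tau>_pos by simp
  qed
qed

lemma resolved_point_bounds:
  assumes "resolved K V" "(x, h) \<in> points (K, V)"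
  shows "uL \<le> h" "h \<le> uR"
proof -
  have "x = x0 + ((x - x0) / \<tau>) * \<tau>"
    using \<tau>_pos by simp
  then have "(x0 + ((x - x0) / \<tau>) * \<tau>, h) \<in> points (K, V)"
    using assms(2) by metis
  then have "uL \<le> h \<and> h \<le> uR"
    by (rule resolved_point[OF assms(1)]) (force dest: contactD)+
  then show "uL \<le> h" "h \<le> uR" by auto
qed

lemma resolved_point_contact:
  assumes "resolved K V" "(x0 + \<xi> * \<tau>, h) \<in> points (K, V)" "\<xi> \<notin> shock_speeds"
  shows "h \<in> contact \<xi>"
  using assms(1,2) by (rule resolved_point) (use assms(3) in \<open>auto simp: shock_speeds_def\<close>)

lemma resolved_shock_hull_secant:
  assumes "resolved K V" "(y, a, b) \<in> V"
  shows "hull_secant F uL uR a b"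
  using assms unfolding resolved_def shocks_on_hull_def hull_secant_iff by blast

lemma resolved_kept_hull:
  assumes "resolved K V" "p \<in> K"
  shows "LconF F uL uR (u p) = F (u p)"
  using assms LconF_contact unfolding resolved_def kept_on_hull_def by blast

text \<open>Every speed has a contact point, so no position is left empty. At uL and uR,
  \<open>contact_mono\<close> shows that a contact point is never cut off; an inner height hidden in
  a vertical line determines its slope, so that line stands at the right position.\<close>

lemma resolved_covers_contact:
  assumes "resolved K V" "v \<in> contact \<xi>"
  shows "(x0 + \<xi> * \<tau>, v) \<in> points (K, V)"
proof -
  have res: "shocks_on_hull V" "right_resolved K V" "left_resolved K V"
    "\<And>p. 0 < p \<Longrightarrow> p < 1 \<Longrightarrow> front_point_resolved K V p"
    using assms by (auto simp: resolved_def)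
  consider "v = uL" | "v = uR" | "uL < v" "v < uR"
    using contactD[OF assms(2)] by force
  then show ?thesis
  proof cases
    case 1
    note s = arc_start[of v \<xi>, OF assms(2)]
    let ?p = "arc_start \<xi> v"
    have p: "speed ?p = \<xi>" "u ?p = v" "?p \<le> 0"
      using s 1 uL_less_uR by auto
    have "?p \<in> K"
    proof (rule ccontr)
      assume "?p \<notin> K"
      then obtain \<zeta> b where b: "(x0 + \<zeta> * \<tau>, uL, b) \<in> V" "\<zeta> < \<xi>"
        using res(3) p unfolding left_resolved_def by metis
      then obtain \<zeta>' where "x0 + \<zeta> * \<tau> = x0 + \<zeta>' * \<tau>" "uL < b" "b \<in> contact \<zeta>'"
        using res(1) unfolding shocks_on_hull_def by blast
      then show False
        using contact_mono[of b \<zeta> v \<xi>] assms(2) b 1 \<tau>_pos by simp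
    qed
    then show ?thesis
      using kept_point[of ?p K V] p by simp
  next
    case 2
    note e = arc_end[of v \<xi>, OF assms(2)]
    let ?p = "arc_end \<xi> v"
    have p: "speed ?p = \<xi>" "u ?p = v" "1 \<le> ?p"
      using e 2 uL_less_uR by auto
    have "?p \<in> K"
    proof (rule ccontr)
      assume "?p \<notin> K"
      then obtain \<zeta> a where a: "(x0 + \<zeta> * \<tau>, a, uR) \<in> V" "\<xi> < \<zeta>"
        using res(2) p unfolding right_resolved_def by metis
      then obtain \<zeta>' where "x0 + \<zeta> * \<tau> = x0 + \<zeta>' * \<tau>" "a < uR" "a \<in> contact \<zeta>'"
        using res(1) unfolding shocks_on_hull_def by blast
      then show False
        using contact_mono[of v \<xi> a \<zeta>] assms(2) a 2 \<tau>_pos by simp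
    qed
    then show ?thesis
      using kept_point[of ?p K V] p by simp
  next
    case 3
    define p where "p = arc_start \<xi> v"
    have p: "speed p = \<xi>" "u p = v" "0 < p" "p < 1"
      using arc_start[OF assms(2)] 3 by (auto simp: p_def not_le[symmetric])
    then consider "p \<in> K" | y a b where "(y, a, b) \<in> V" "a \<le> v" "v \<le> b"
      using res(4)[of p] unfolding front_point_resolved_def by blast
    then show ?thesis
    proof cases
      case 1
      then show ?thesis
        using kept_point[of p K V] p by simp
    next
      case 2
      then obtain \<zeta> where \<zeta>: "y = x0 + \<zeta> * \<tau>" "a \<in> contact \<zeta>" "b \<in> contact \<zeta>"
        using res(1) unfolding shocks_on_hull_def by blast
      have "v \<in> contact \<zeta>"
        using contact_between[OF \<zeta>(2,3) assms(2) 2(2,3)] .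
      then have "\<zeta> = \<xi>"
        using contact_slope_eq assms(2) 3 by metis
      then show ?thesis
        using shock_point 2 \<zeta>(1) by blast
    qed
  qed
qed

lemma resolved_covers_height:
  assumes "resolved K V" "uL \<le> h" "h \<le> uR"
  shows "\<exists>x. (x, h) \<in> points (K, V)"
proof -
  consider "h = uL" | "h = uR" | "uL < h" "h < uR"
    using assms by force
  then show ?thesis
  proof cases
    case 1
    obtain R where "uL \<in> contact R"
      using contact_left_end by blast
    then show ?thesis
      using resolved_covers_contact[OF assms(1)] 1 by blast
  next
    case 2
    obtain R where "uR \<in> contact R"
      using contact_right_end by blast
    then show ?thesis
      using resolved_covers_contact[OF assms(1)] 2 by blast
  next
    case 3
    let ?p = "(h - uL) / (uR - uL)"
    have p: "u ?p = h" "0 < ?p" "?p < 1"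
      using u_height assms 3 by auto
    then have "front_point_resolved K V ?p"
      using assms(1) by (simp add: resolved_def)
    then show ?thesis
      using p(1) kept_point[of ?p K V] shock_point[of _ _ _ V h K] unfolding front_point_resolved_def
      by auto
  qed
qed

text \<open>Two kept points at one position are contact points of the same speed, hence the ends of
  an equal-area arc. Its final end contradicts \<open>kept_on_hull\<close> on the front and
  \<open>right_resolved\<close> on the right state.\<close>

lemma resolved_unique:
  assumes "resolved K V" "x \<notin> fst ` V" "(x, h) \<in> points (K, V)" "(x, h') \<in> points (K, V)"
  shows "h = h'"
proof -
  define \<xi> where "\<xi> = (x - x0) / \<tau>"
  have x: "x = x0 + \<xi> * \<tau>"
    using \<tau>_pos by (simp add: \<xi>_def)
  have noV: "(x0 + \<xi> * \<tau>, a, b) \<notin> V" for a b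
    using assms(2) x by force
  have "\<not> h < h'" if pts: "(x, h) \<in> points (K, V)" "(x, h') \<in> points (K, V)" for h h'
  proof
    assume "h < h'"
    obtain p where p: "p \<in> K" "speed p = \<xi>" "u p = h" "h \<in> contact \<xi>"
      using pts(1) unfolding x by (rule resolved_point[OF assms(1)]) (use noV in blast)+
    obtain q where q: "q \<in> K" "speed q = \<xi>" "u q = h'" "h' \<in> contact \<xi>"
      using pts(2) unfolding x by (rule resolved_point[OF assms(1)]) (use noV in blast)+
    have "p < q"
      using u_mono[of q p] p q \<open>h < h'\<close> by force
    then have "EA p q"
      using p q contact_eq[OF p(4) q(4)] by (simp add: equal_area_iff)
    have "0 < q"
      using u_left[of q] q(3) \<open>h < h'\<close> contactD(1)[OF p(4)] by linarith
    show False
    proof (cases "q < 1")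
      case True
      then show False
        using assms(1) q(1) \<open>EA p q\<close> \<open>0 < q\<close> by (auto simp: resolved_def kept_on_hull_def)
    next
      case False
      then have "h' = uR"
        using q by simp
      then have "\<exists>c d. (x0 + \<xi> * \<tau>, c, d) \<in> V"
        using assms(1) p(4) q(4) \<open>h < h'\<close> unfolding resolved_def right_resolved_def by blast
      then show False
        using noV by blast
    qed
  qed
  then show ?thesis
    using assms(3,4) by (meson linorder_neqE_linordered_idom)
qed

section \<open>Existence of a terminating run\<close>

lemma selectedI:
  assumes "to_right p" "uR \<in> contact (speed p)"
  shows "selected_shock_to_right F x0 uL uR \<tau> p"
  unfolding selected_shock_to_right_def
proof (intro conjI allI impI)
  fix q assume "to_right q"
  then obtain r where q: "q < 1" "1 \<le> r" "EA q r"
    by (auto simp: shock_to_right_def)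
  have "u q < uR"
    using u_less_iff[of "max q 0" 1] q uL_less_uR by (cases "q \<le> 0") (auto simp: max_def)
  \<comment> \<open>The chord to uR has slope \<open>speed q\<close>, which cannot exceed the slope
    of a supporting line at uR.\<close>
  have "F (u q) - speed q * u q = F uR - speed q * uR"
    using q(2,3) u_right unfolding equal_area_iff by metis
  moreover have "F uR - speed p * uR \<le> F (u q) - speed p * u q"
    using contactD(3)[OF assms(2)] u_bounds by blast
  ultimately have "speed q * (uR - u q) \<le> speed p * (uR - u q)"
    by (simp add: algebra_simps)
  then show "X q \<le> X p"
    using \<open>u q < uR\<close> \<tau>_pos by (simp add: X_eq)
qed (use assms in simp)

text \<open>No limit of arcs is needed: if the given arc is not on a supporting line at uR,
  \<open>slope_to_right\<close> produces one that is.\<close>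

lemma selected_exists:
  assumes "to_right p"
  shows "\<exists>q. selected_shock_to_right F x0 uL uR \<tau> q"
proof (cases "uR \<in> contact (speed p)")
  case True
  then show ?thesis
    using selectedI assms by blast
next
  case False
  obtain q where q: "p < 1" "1 \<le> q" "EA p q"
    using assms by (auto simp: shock_to_right_def)
  then have "f uR \<le> speed p"
    using speed_right[of q] \<tau>_pos by (auto simp: equal_area_iff)
  moreover obtain v where "uL \<le> v" "v \<le> uR" "F v - speed p * v < F uR - speed p * uR"
    using False uL_less_uR by (auto simp: contact_def not_le)
  ultimately obtain \<sigma> a where \<sigma>: "a < uR" "a \<in> contact \<sigma>" "uR \<in> contact \<sigma>"
    using slope_to_right by metis
  then show ?thesis
    using selectedI[of "arc_start \<sigma> a"] to_right_contact arc_start by auto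
qed

text \<open>Suppose the supremum \<open>t\<^sub>1\<close> of the ends is missed, and let c be its
  height. Then no secant ends at c, so each shock speed keeps its contact points below c away from
  c, and finitely many speeds share a bound M < c. An end with height between M and c contradicts
  this. Finiteness rules out secants accumulating at c from below.\<close>

lemma largest_front_end_exists:
  assumes "ready s" "finite shock_speeds" "front_end F x0 uL uR \<tau> s t"
  shows "\<exists>t. largest_front_end F x0 uL uR \<tau> s t"
proof -
  define T where "T = {t. front_end F x0 uL uR \<tau> s t}"
  define t\<^sub>1 where "t\<^sub>1 = Sup T"
  have s: "0 < s" "s \<le> 1" "s = 1 \<Longrightarrow> \<nexists>p. to_right p"
    using assms(1) by (auto simp: ready_def)
  have "t \<in> T"
    using assms(3) by (simp add: T_def)
  have "bdd_above T"
    by (rule bdd_aboveI[of _ s]) (simp add: T_def front_end_def)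
  then have upper: "t' \<le> t\<^sub>1" if "t' \<in> T" for t'
    unfolding t\<^sub>1_def using that by (rule cSup_upper[rotated])
  have "t\<^sub>1 \<le> s"
    unfolding t\<^sub>1_def by (rule cSup_least) (use \<open>t \<in> T\<close> in \<open>auto simp: T_def front_end_def\<close>)
  have "0 < t\<^sub>1"
    using upper[OF \<open>t \<in> T\<close>] assms(3) by (simp add: front_end_def)
  define c where "c = u t\<^sub>1"
  have c: "c \<in> contact (speed t\<^sub>1)"
    unfolding c_def using contact_above_front_ends[OF assms(1), of t\<^sub>1 t\<^sub>1] upper \<open>t\<^sub>1 \<le> s\<close> \<open>0 < t\<^sub>1\<close>
    by (auto simp: T_def)
  have "uL < c"
    using u_less_iff[of 0 t\<^sub>1] \<open>0 < t\<^sub>1\<close> \<open>t\<^sub>1 \<le> s\<close> s(2) by (simp add: c_def)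
  have "t\<^sub>1 \<in> T"
  proof (rule ccontr)
    assume "t\<^sub>1 \<notin> T"
    have no_secant: False if ac: "a \<in> contact \<sigma>" "c \<in> contact \<sigma>" "a < c" for a \<sigma>
    proof (cases "t\<^sub>1 < 1")
      case True
      then have "c < uR"
        using u_inner_iff[of t\<^sub>1] \<open>0 < t\<^sub>1\<close> by (simp add: c_def)
      then have "arc_end \<sigma> c = t\<^sub>1"
        using u_front[of t\<^sub>1] True \<open>0 < t\<^sub>1\<close> uL_less_uR by (simp add: arc_end_def c_def)
      then have "EA (arc_start \<sigma> a) t\<^sub>1"
        using equal_area_contact[OF ac] by simp
      then show False
        using \<open>t\<^sub>1 \<notin> T\<close> \<open>0 < t\<^sub>1\<close> \<open>t\<^sub>1 \<le> s\<close> by (auto simp: T_def front_end_def)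
    next
      case False
      then have "s = 1" "c = uR"
        using \<open>t\<^sub>1 \<le> s\<close> s(2) by (auto simp: c_def)
      then show False
        using to_right_contact ac s(3) by blast
    qed
    \<comment> \<open>A contact set with points below c and points at or above c would contain c,
      against \<open>no_secant\<close>. So either its largest point is below c, or no point is, and
      uL is a dummy bound.\<close>
    have "\<exists>m<c. \<forall>b\<in>contact \<zeta>. b < c \<longrightarrow> b \<le> m" for \<zeta>
    proof -
      obtain b\<^sub>0 where b\<^sub>0: "b\<^sub>0 \<in> contact \<zeta>" "\<And>v. v \<in> contact \<zeta> \<Longrightarrow> v \<le> b\<^sub>0"
        using contact_extremes[of \<zeta>] by metis
      show ?thesis
      proof (cases "b\<^sub>0 < c")
        case True
        then show ?thesis using b\<^sub>0 by blast
      next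
        case False
        have "\<not> b < c" if b: "b \<in> contact \<zeta>" for b
          using no_secant[OF b] contact_between[OF b b\<^sub>0(1) c] False by fastforce
        then show ?thesis using \<open>uL < c\<close> by blast
      qed
    qed
    then obtain m where m: "\<And>\<zeta>. m \<zeta> < c" "\<And>\<zeta> b. b \<in> contact \<zeta> \<Longrightarrow> b < c \<Longrightarrow> b \<le> m \<zeta>"
      by metis
    \<comment> \<open>Inserting uL keeps the set nonempty and makes M a height.\<close>
    define M where "M = Max (insert uL (m ` shock_speeds))"
    have "M < c" "uL \<le> M"
      using assms(2) m(1) \<open>uL < c\<close> by (auto simp: M_def)
    have M: "b \<le> M" if "\<zeta> \<in> shock_speeds" "b \<in> contact \<zeta>" "b < c" for \<zeta> b
    proof -
      have "m \<zeta> \<le> M"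
        unfolding M_def using assms(2) that(1) by (intro Max_ge) auto
      then show ?thesis
        using m(2)[OF that(2,3)] by simp
    qed
    define r where "r = (M - uL) / (uR - uL)"
    have "M \<le> uR"
      using \<open>M < c\<close> u_bounds[of t\<^sub>1] by (simp add: c_def)
    then have r: "0 \<le> r" "u r = M" "r \<le> 1"
      using u_height \<open>uL \<le> M\<close> uL_less_uR by (auto simp: r_def)
    have "r < t\<^sub>1"
      using u_less_iff[of r t\<^sub>1] r \<open>M < c\<close> \<open>t\<^sub>1 \<le> s\<close> s(2) by (simp add: c_def)
    then obtain t' where t': "t' \<in> T" "r < t'"
      using less_cSupD[of T r] \<open>t \<in> T\<close> unfolding t\<^sub>1_def by auto
    have "t' < t\<^sub>1"
      using upper[OF t'(1)] t'(1) \<open>t\<^sub>1 \<notin> T\<close> by (metis order_le_less)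
    obtain p where p: "EA p t'"
      using t'(1) by (auto simp: T_def front_end_def)
    define v where "v = u t'"
    have v: "M < v" "v < c" "uL < v" "v < uR"
      using u_less_iff[of r t'] u_less_iff[of t' t\<^sub>1] r t'(2) \<open>t' < t\<^sub>1\<close> \<open>t\<^sub>1 \<le> s\<close> s(2)
        \<open>uL \<le> M\<close> u_bounds[of t\<^sub>1] by (auto simp: v_def c_def)
    obtain \<sigma> a b where ab: "a \<in> contact \<sigma>" "b \<in> contact \<sigma>" "a \<le> v" "v \<le> b"
      by (rule contact_straddle[of v]) (use v in auto)
    \<comment> \<open>A secant strictly over v ends above M, hence at c or beyond, which would make
      c a contact point of its slope.\<close>
    have "v \<in> contact \<sigma>"
    proof (rule ccontr)
      assume "v \<notin> contact \<sigma>"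
      with ab have "a < v" "v < b"
        by (metis order_le_less)+
      then have "\<sigma> \<in> shock_speeds"
        unfolding shock_speeds_def using ab by (intro CollectI exI[of _ a] exI[of _ b]) simp
      then have "\<not> b < c"
        using M[OF _ ab(2)] v \<open>v < b\<close> by force
      then have "c \<in> contact \<sigma>"
        using contact_between[OF ab(1,2) c] ab v by simp
      then show False
        using no_secant[OF ab(1)] ab(3) v by simp
    qed
    moreover have "speed t' = f v"
      using speed_front[of t'] t'(2) r \<open>t' < t\<^sub>1\<close> \<open>t\<^sub>1 \<le> s\<close> s(2) by (simp add: v_def)
    ultimately have sv: "v \<in> contact (speed t')"
      using contact_slope_eq v by metis
    have up: "u p \<in> contact (speed t')"
      by (rule contact_transfer[OF sv]) (use p u_bounds in \<open>auto simp: equal_area_iff v_def\<close>)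
    moreover have "u p < v"
    proof -
      have "p < t'"
        using p by (simp add: equal_area_iff)
      then show ?thesis
        using u_less_iff[of "max p 0" t'] \<open>t' < t\<^sub>1\<close> \<open>t\<^sub>1 \<le> s\<close> s(2) t'(2) r(1) \<open>uL < v\<close>
        by (cases "p \<le> 0") (auto simp: v_def max_def)
    qed
    ultimately have "speed t' \<in> shock_speeds"
      using sv by (auto simp: shock_speeds_def)
    then show False
      using M[OF _ sv v(2)] v(1) by simp
  qed
  then show ?thesis
    using upper by (auto simp: largest_front_end_def T_def)
qed

text \<open>The measure counts the shock speeds with a contact point below the current height. Among
  the admissible arcs the one starting at the least contact point is chosen; a shorter one would
  leave its speed in the count.\<close>

lemma geap_front_exists:
  assumes "finite shock_speeds" "ready s"
  shows "\<exists>D. geap_front F x0 uL uR \<tau> s C D"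
  using assms(2)
proof (induction "card {\<zeta> \<in> shock_speeds. \<exists>a\<in>contact \<zeta>. a < u s}" arbitrary: s C rule: less_induct)
  case less
  obtain K V where C: "C = (K, V)"
    by (cases C)
  show ?case
  proof (cases "\<exists>t. front_end F x0 uL uR \<tau> s t")
    case False
    then show ?thesis
      using geap_front.stop by blast
  next
    case True
    then obtain t where t: "largest_front_end F x0 uL uR \<tau> s t"
      using largest_front_end_exists[OF less(2) assms(1)] by blast
    note t' = largest_front_end_contact[OF less(2) t]
    define \<xi> where "\<xi> = f (u t)"
    obtain p0 where "EA p0 t"
      using t by (auto simp: largest_front_end_def front_end_def)
    then have p0: "u p0 \<in> contact \<xi>" "u p0 < u t"
      using t'(6) by (auto simp: \<xi>_def)
    have ut: "u t \<in> contact \<xi>"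
      using t'(4)[of t] t'(1-3) speed_front[of t] by (simp add: \<xi>_def)
    then have "\<xi> \<in> shock_speeds"
      using p0 by (auto simp: shock_speeds_def)
    have ut_inner: "uL < u t" "u t < uR"
      using u_inner_iff[of t] t'(1,2) by auto
    obtain a where a: "a \<in> contact \<xi>" "\<And>v. v \<in> contact \<xi> \<Longrightarrow> a \<le> v"
      using contact_extremes[of \<xi>] by metis
    have "a < u t"
      using a(2)[OF p0(1)] p0(2) by simp
    define q where "q = arc_start \<xi> a"
    have "arc_end \<xi> (u t) = t"
      using u_front[of t] t'(1,2) uL_less_uR ut_inner by (simp add: arc_end_def)
    then have q: "EA q t"
      using equal_area_contact[OF a(1) ut \<open>a < u t\<close>] by (simp add: q_def)
    have uq: "u q = a" "speed q = \<xi>" "q < 1"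
      using arc_start[OF a(1)] \<open>a < u t\<close> ut_inner by (auto simp: q_def)
    show ?thesis
    proof (cases "q \<le> 0")
      case True
      then show ?thesis
        unfolding C using geap_front.to_left[OF t True q] by blast
    next
      case False
      then have "0 < q" by simp
      have "ready q"
        using \<open>0 < q\<close> uq a(1) by (simp add: ready_def)
      have "u t \<le> u s"
        using t'(3) by (rule u_mono)
      then have "{\<zeta> \<in> shock_speeds. \<exists>a\<in>contact \<zeta>. a < u q} \<subset> {\<zeta> \<in> shock_speeds. \<exists>a\<in>contact \<zeta>. a < u s}"
        using \<open>\<xi> \<in> shock_speeds\<close> a \<open>a < u t\<close> uq(1) by force
      then have "card {\<zeta> \<in> shock_speeds. \<exists>a\<in>contact \<zeta>. a < u q} <
          card {\<zeta> \<in> shock_speeds. \<exists>a\<in>contact \<zeta>. a < u s}"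
        using assms(1) by (intro psubset_card_mono) auto
      then obtain D where "geap_front F x0 uL uR \<tau> q
          (K - {q..t}, insert (x0 + f (u t) * \<tau>, u q, u t) V) D"
        using less(1)[OF _ \<open>ready q\<close>] by blast
      then show ?thesis
        unfolding C using geap_front.inner[OF t \<open>0 < q\<close> q] by blast
    qed
  qed
qed

lemma geap_exists:
  assumes "finite (maximal_hull_secants F uL uR)"
  shows "\<exists>C. geap F x0 uL uR \<tau> C"
proof -
  note front = geap_front_exists[OF finite_shock_speeds[OF assms]]
  show ?thesis
  proof (cases "\<exists>p. to_right p")
    case True
    then obtain p where p: "selected_shock_to_right F x0 uL uR \<tau> p"
      using selected_exists by blast
    show ?thesis
    proof (cases "p \<le> 0")
      case True
      then show ?thesis
        using geap.whole[OF p] by blast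
    next
      case False
      then have "ready p"
        using selected_contact[OF p] by (auto simp: ready_def)
      then show ?thesis
        using front geap.to_right[OF p] False by (meson not_le)
    qed
  next
    case False
    then have "ready 1"
      using no_shock_contact by (auto simp: ready_def speed_right)
    then show ?thesis
      using front geap.no_shock[OF False] by blast
  qed
qed

end

section \<open>Self-similar weak solutions\<close>

lemma integrable_compact_support:
  fixes g h :: "'a::euclidean_space \<Rightarrow> real"
  assumes "compact S" "continuous_on UNIV g" "\<And>z. z \<notin> S \<Longrightarrow> g z = 0"
    and "h \<in> borel_measurable borel" "\<And>z. \<bar>h z\<bar> \<le> C"
  shows "integrable lborel (\<lambda>z. h z * g z)"
proof (rule Bochner_Integration.integrable_bound)
  have "integrable lborel (\<lambda>z. indicator S z *\<^sub>R g z)"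
    by (rule borel_integrable_compact[OF assms(1) continuous_on_subset[OF assms(2)]]) auto
  also have "(\<lambda>z. indicator S z *\<^sub>R g z) = g"
    using assms(3) by (intro ext) (auto simp: indicator_def)
  finally show "integrable lborel (\<lambda>z. C * g z)"
    by simp
  have "g \<in> borel_measurable borel"
    using assms(2) by (rule borel_measurable_continuous_onI)
  then show "(\<lambda>z. h z * g z) \<in> borel_measurable lborel"
    using assms(4) by simp
  have "0 \<le> C"
    using assms(5) abs_ge_zero order_trans by blast
  show "AE z in lborel. norm (h z * g z) \<le> norm (C * g z)"
    using assms(5) \<open>0 \<le> C\<close> by (auto simp: abs_mult intro!: mult_right_mono)
qed

section \<open>Test functions and their integrals along rays\<close>

locale test_fun =
  fixes \<phi> \<phi>x \<phi>t :: "real \<times> real \<Rightarrow> real"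
  assumes test: "test_function \<phi> \<phi>x \<phi>t"
begin

lemma partial_x: "((\<lambda>y. \<phi> (y, t)) has_real_derivative \<phi>x (x, t)) (at x)"
  and partial_t: "((\<lambda>s. \<phi> (x, s)) has_real_derivative \<phi>t (x, t)) (at t)"
  and cont_x: "continuous_on UNIV \<phi>x" and cont_t: "continuous_on UNIV \<phi>t"
  using test by (auto simp: test_function_def)

definition support :: "(real \<times> real) set" where "support = closure {z. \<phi> z \<noteq> 0}"

lemma compact_support: "compact support"
  using test by (simp add: test_function_def support_def)

lemma \<phi>_zero: "z \<notin> support \<Longrightarrow> \<phi> z = 0"
  using closure_subset[of "{z. \<phi> z \<noteq> 0}"] by (auto simp: support_def)

lemma \<phi>x_zero: "\<phi>x z = 0" if "z \<notin> support"
proof -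
  obtain x t where z: "z = (x, t)" by (cases z)
  have "open ((\<lambda>y. (y, t)) -` (- support))"
    using compact_imp_closed[OF compact_support] by (intro open_vimage continuous_intros) auto
  then have "((\<lambda>y. \<phi> (y, t)) has_real_derivative 0) (at x)"
    by (rule has_field_derivative_transform_within_open[OF DERIV_const])
      (use that z \<phi>_zero in auto)
  then show ?thesis
    using DERIV_unique[OF partial_x] z by simp
qed

lemma \<phi>t_zero: "\<phi>t z = 0" if "z \<notin> support"
proof -
  obtain x t where z: "z = (x, t)" by (cases z)
  have "open ((\<lambda>s. (x, s)) -` (- support))"
    using compact_imp_closed[OF compact_support] by (intro open_vimage continuous_intros) auto
  then have "((\<lambda>s. \<phi> (x, s)) has_real_derivative 0) (at t)"
    by (rule has_field_derivative_transform_within_open[OF DERIV_const])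
      (use that z \<phi>_zero in auto)
  then show ?thesis
    using DERIV_unique[OF partial_t] z by simp
qed

lemma integrable_\<phi>x:
  assumes "h \<in> borel_measurable borel" "\<And>z. \<bar>h z\<bar> \<le> C"
  shows "integrable lborel (\<lambda>z. h z * \<phi>x z)"
  using integrable_compact_support[OF compact_support cont_x \<phi>x_zero assms] .

lemma integrable_\<phi>t:
  assumes "h \<in> borel_measurable borel" "\<And>z. \<bar>h z\<bar> \<le> C"
  shows "integrable lborel (\<lambda>z. h z * \<phi>t z)"
  using integrable_compact_support[OF compact_support cont_t \<phi>t_zero assms] .

text \<open>Only partial derivatives are given; the chain rule along slanted rays needs the total
  derivative, which continuity of \<open>\<phi>t\<close> provides.\<close>

lemma has_derivative_\<phi>:
  "(\<phi> has_derivative (\<lambda>(a, b). \<phi>x z * a + \<phi>t z * b)) (at z)"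
proof -
  obtain x t where z: "z = (x, t)" by (cases z)
  have "((\<lambda>(x, t). \<phi> (x, t)) has_derivative
      (\<lambda>(a, b). \<phi>x (x, t) * a + blinfun_apply (blinfun_mult_right (\<phi>t (x, t))) b)) (at (x, t) within UNIV \<times> UNIV)"
  proof (rule has_derivative_partialsI)
    show "((\<lambda>x. \<phi> (x, t)) has_derivative (*) (\<phi>x (x, t))) (at x)"
      using partial_x by (simp add: has_field_derivative_def)
    show "((\<lambda>t. \<phi> (x, t)) has_derivative blinfun_apply (blinfun_mult_right (\<phi>t (x, t)))) (at t)" for x t
      using partial_t by (simp add: has_field_derivative_def)
    have "continuous_on UNIV (\<lambda>z. blinfun_mult_right (\<phi>t z))"
      by (rule bounded_linear.continuous_on[OF bounded_linear_blinfun_mult_right cont_t])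
    then show "continuous (at (x, t) within UNIV \<times> UNIV) (\<lambda>(x, t). blinfun_mult_right (\<phi>t (x, t)))"
      by (simp add: continuous_on_eq_continuous_within split_def)
  qed auto
  then show ?thesis
    using z by (simp add: split_def)
qed

lemma \<phi>_along_ray:
  "((\<lambda>t. \<phi> (y + c * t, t)) has_real_derivative
     \<phi>t (y + c * t, t) + c * \<phi>x (y + c * t, t)) (at t)"
proof -
  have "((\<lambda>t. (y + c * t, t)) has_derivative (\<lambda>h. (c * h, h))) (at t)"
    by (auto intro!: derivative_eq_intros)
  from has_derivative_compose[OF this has_derivative_\<phi>] show ?thesis
    by (rule has_derivative_imp_has_field_derivative) (simp add: algebra_simps)
qed

text \<open>The union of the forward rays of speed c that leave the axis t = 0 at points of A: the
  half plane for A = UNIV, the region to the right of a shock for a half-line.\<close>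

definition ray :: "real \<Rightarrow> real set \<Rightarrow> (real \<times> real) set" where
  "ray c A = {z. 0 < snd z \<and> fst z - c * snd z \<in> A}"

lemma sets_ray [measurable]:
  assumes "A \<in> sets borel"
  shows "ray c A \<in> sets borel"
proof -
  have "(\<lambda>z::real \<times> real. fst z - c * snd z) \<in> borel_measurable borel"
    by (intro borel_measurable_continuous_onI continuous_intros)
  from measurable_sets[OF this assms] have "{z. fst z - c * snd z \<in> A} \<in> sets borel"
    by (simp add: vimage_def)
  moreover have "{z::real \<times> real. 0 < snd z} \<in> sets borel"
    by (intro borel_open open_Collect_less continuous_intros)
  ultimately show ?thesis
    by (simp add: ray_def Collect_conj_eq)
qed

text \<open>
  In the moving frame \<open>y = x - c t\<close> the integrand is an exact time derivative.
\<close>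

lemma ray_integral:
  assumes A [measurable]: "A \<in> sets borel"
  shows "(LINT z|lborel. indicator (ray c A) z * (\<phi>t z + c * \<phi>x z)) =
    - (LINT x|lborel. indicator A x * \<phi> (x, 0))"
proof -
  define g where "g z = \<phi>t z + c * \<phi>x z" for z
  have g: "continuous_on UNIV g" "\<And>z. z \<notin> support \<Longrightarrow> g z = 0"
    unfolding g_def by (intro continuous_intros cont_x cont_t) (simp add: \<phi>x_zero \<phi>t_zero)
  obtain B where B: "\<And>z. z \<in> support \<Longrightarrow> norm z \<le> B"
    using compact_imp_bounded[OF compact_support] unfolding bounded_iff by blast
  have outside: "(x, t) \<notin> support" if "\<bar>B\<bar> < t" for x t
    using B[of "(x, t)"] that norm_snd_le[of t x] by fastforce
  have int: "integrable (lborel \<Otimes>\<^sub>M lborel) (\<lambda>(x, t). indicator (ray c A) (x, t) * g (x, t))"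
    unfolding lborel_prod split_def prod.collapse
    by (rule integrable_compact_support[OF compact_support g, of _ 1])
      (auto intro!: borel_measurable_indicator sets_ray A simp: indicator_def)
  have int': "integrable (lborel \<Otimes>\<^sub>M lborel)
      (\<lambda>(y, t). indicator {0<..} t * indicator A y * g (y + c * t, t))"
  proof -
    have "integrable lborel (\<lambda>z::real \<times> real. (indicator {0<..} (snd z) * indicator A (fst z)) *
        g (fst z + c * snd z, snd z))"
    proof (rule integrable_compact_support[where C = 1])
      show "compact ((\<lambda>z. (fst z - c * snd z, snd z)) ` support)"
        by (intro compact_continuous_image compact_support continuous_intros)
      show "continuous_on UNIV (\<lambda>z::real \<times> real. g (fst z + c * snd z, snd z))"
        by (rule continuous_on_compose2[OF g(1)]) (auto intro!: continuous_intros)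
      show "g (fst z + c * snd z, snd z) = 0"
        if "z \<notin> (\<lambda>z. (fst z - c * snd z, snd z)) ` support" for z :: "real \<times> real"
        by (rule g(2)) (use that in \<open>force simp: image_iff\<close>)
      show "(\<lambda>z::real \<times> real. indicator {0<..} (snd z) * indicator A (fst z) :: real)
          \<in> borel_measurable borel"
        unfolding borel_prod[symmetric] by measurable
    qed (auto simp: indicator_def)
    then show ?thesis
      by (simp add: lborel_prod split_def)
  qed
  have "(LINT z|lborel. indicator (ray c A) z * g z) =
      (LINT t|lborel. LINT x|lborel. indicator (ray c A) (x, t) * g (x, t))"
    using lborel_pair.integral_snd[OF int] by (simp add: lborel_prod split_def)
  also have "\<dots> = (LINT t|lborel. LINT y|lborel. indicator {0<..} t * indicator A y * g (y + c * t, t))"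
  proof (rule Bochner_Integration.integral_cong[OF refl])
    fix t :: real
    \<comment> \<open>At fixed t the shift x = y + c t straightens the rays.\<close>
    show "(LINT x|lborel. indicator (ray c A) (x, t) * g (x, t)) =
        (LINT y|lborel. indicator {0<..} t * indicator A y * g (y + c * t, t))"
      by (subst lborel_integral_real_affine[of 1 _ "c * t"])
        (auto intro!: Bochner_Integration.integral_cong simp: ray_def indicator_def add.commute)
  qed
  also have "\<dots> = (LINT y|lborel. LINT t|lborel. indicator {0<..} t * indicator A y * g (y + c * t, t))"
    by (rule lborel_pair.Fubini_integral[OF int'])
  also have "\<dots> = (LINT y|lborel. - (indicator A y * \<phi> (y, 0)))"
  proof (rule Bochner_Integration.integral_cong[OF refl])
    fix y :: real
    \<comment> \<open>A time after the support has ended, so the upper boundary term is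
      zero.\<close>
    define b where "b = \<bar>B\<bar> + 1"
    have "(LINT t|lborel. indicator {0<..} t * indicator A y * g (y + c * t, t)) =
        (LINT t|lborel. indicator A y * (g (y + c * t, t) * indicator {0..b} t))"
    proof (rule integral_discrete_difference[where X = "{0}"])
      show "indicator {0<..} t * indicator A y * g (y + c * t, t) =
          indicator A y * (g (y + c * t, t) * indicator {0..b} t)" if "t \<notin> {0}" for t
        using that g(2)[OF outside[of t]] by (auto simp: indicator_def b_def)
    qed auto
    also have "\<dots> = indicator A y * (LINT t|lborel. g (y + c * t, t) * indicator {0..b} t)"
      by simp
    also have "(LINT t|lborel. g (y + c * t, t) * indicator {0..b} t) =
        \<phi> (y + c * b, b) - \<phi> (y + c * 0, 0)"
    proof (rule integral_FTC_Icc_real)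
      show "((\<lambda>t. \<phi> (y + c * t, t)) has_real_derivative g (y + c * t, t)) (at t)" for t
        unfolding g_def by (rule \<phi>_along_ray)
      have "continuous_on UNIV (\<lambda>t. g (y + c * t, t))"
        by (rule continuous_on_compose2[OF g(1)]) (auto intro!: continuous_intros)
      then show "isCont (\<lambda>t. g (y + c * t, t)) t" for t
        by (simp add: continuous_on_eq_continuous_at)
    qed (simp add: b_def)
    also have "\<phi> (y + c * b, b) = 0"
      by (intro \<phi>_zero outside) (simp add: b_def)
    finally show "(LINT t|lborel. indicator {0<..} t * indicator A y * g (y + c * t, t)) =
        - (indicator A y * \<phi> (y, 0))"
      by simp
  qed
  finally show ?thesis
    by (simp add: g_def)
qed

lemma integrable_\<phi>_0:
  assumes "A \<in> sets borel"
  shows "integrable lborel (\<lambda>x. indicator A x * \<phi> (x, 0))"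
proof (rule integrable_compact_support[where C = 1])
  show "compact (fst ` support)"
    by (intro compact_continuous_image compact_support continuous_intros)
  show "continuous_on UNIV (\<lambda>x. \<phi> (x, 0))"
    using partial_x DERIV_isCont continuous_at_imp_continuous_on by blast
  show "\<phi> (x, 0) = 0" if "x \<notin> fst ` support" for x
    by (rule \<phi>_zero) (use that in force)
  show "indicator A \<in> borel_measurable borel"
    using assms by simp
qed (auto simp: indicator_def)

end

text \<open>A step function written as a sum of jumps: for a self-similar argument each jump lives
  on a \<open>ray\<close> set, whose integral is known.\<close>

definition stair :: "(real \<Rightarrow> real) \<Rightarrow> (nat \<Rightarrow> real) \<Rightarrow> nat \<Rightarrow> real \<Rightarrow> real" where
  "stair k g n \<xi> = k (g 0) + (\<Sum>i<n. (k (g (Suc i)) - k (g i)) * of_bool (g (Suc i) < \<xi>))"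

lemma stair_value:
  assumes "incseq g"
  shows "\<exists>j\<le>n. stair k g n \<xi> = k (g j) \<and> (j = 0 \<or> g j < \<xi>) \<and> (j = n \<or> \<xi> \<le> g (Suc j))"
proof (induction n)
  case 0
  then show ?case
    by (simp add: stair_def)
next
  case (Suc n)
  then obtain j where j: "j \<le> n" "stair k g n \<xi> = k (g j)" "j = 0 \<or> g j < \<xi>" "j = n \<or> \<xi> \<le> g (Suc j)"
    by blast
  have st: "stair k g (Suc n) \<xi> = stair k g n \<xi> + (k (g (Suc n)) - k (g n)) * of_bool (g (Suc n) < \<xi>)"
    by (simp add: stair_def)
  show ?case
  proof (cases "g (Suc n) < \<xi>")
    case True
    then have "j = n"
      using j(4) incseqD[OF assms, of "Suc j" "Suc n"] j(1) by force
    then show ?thesis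
      using st j(2) True by (intro exI[of _ "Suc n"]) simp
  next
    case False
    then show ?thesis
      using st j by (intro exI[of _ j]) auto
  qed
qed

definition nodes :: "real \<Rightarrow> nat \<Rightarrow> nat \<Rightarrow> real" where
  "nodes R m i = - R + 2 * R * real i / real (Suc m)"

lemma nodes_Suc: "nodes R m (Suc i) = nodes R m i + 2 * R / real (Suc m)"
  by (simp add: nodes_def add_divide_distrib distrib_left)

lemma incseq_nodes:
  assumes "0 < R"
  shows "incseq (nodes R m)"
  unfolding nodes_def using assms
  by (intro incseq_SucI) (auto simp: divide_right_mono mult_left_mono)

text \<open>Outside the nodes the staircase is exact; between them it takes the value at a node no
  further away than the mesh size.\<close>

lemma stair_tendsto:
  assumes "0 < R" "isCont k \<xi>" "\<And>\<zeta>. \<zeta> \<le> - R \<Longrightarrow> k \<zeta> = k (- R)" "\<And>\<zeta>. R \<le> \<zeta> \<Longrightarrow> k \<zeta> = k R"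
  shows "(\<lambda>m. stair k (nodes R m) (Suc m) \<xi>) \<longlonglongrightarrow> k \<xi>"
proof (rule LIMSEQ_I)
  fix e :: real assume "0 < e"
  then obtain d where d: "0 < d" "\<And>\<zeta>. dist \<zeta> \<xi> < d \<Longrightarrow> dist (k \<zeta>) (k \<xi>) < e"
    using assms(2) unfolding continuous_at_eps_delta by (metis dist_commute)
  obtain m\<^sub>0 :: nat where m\<^sub>0: "2 * R / d < real m\<^sub>0"
    using reals_Archimedean2 by blast
  have "norm (stair k (nodes R m) (Suc m) \<xi> - k \<xi>) < e" if "m\<^sub>0 \<le> m" for m
  proof -
    have "2 * R / d < real (Suc m)"
      using m\<^sub>0 that by linarith
    then have mesh: "2 * R / real (Suc m) < d"
      using d(1) by (simp add: field_simps)
    have ends: "nodes R m 0 = - R" "nodes R m (Suc m) = R"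
      by (simp_all add: nodes_def)
    obtain j where j: "j \<le> Suc m" "stair k (nodes R m) (Suc m) \<xi> = k (nodes R m j)"
      "j = 0 \<or> nodes R m j < \<xi>" "j = Suc m \<or> \<xi> \<le> nodes R m (Suc j)"
      using stair_value[OF incseq_nodes[OF assms(1)]] by metis
    consider "\<xi> \<le> - R" | "j = Suc m" "- R < \<xi>" | "- R < \<xi>" "j \<le> m"
      using j(1) by linarith
    then have "k (nodes R m j) = k \<xi> \<or> \<bar>nodes R m j - \<xi>\<bar> < d"
    proof cases
      case 1
      then have "j = 0"
        using j(3) incseqD[OF incseq_nodes[OF assms(1)], of 0 j m] ends by force
      then show ?thesis
        using 1 assms(3)[of \<xi>] ends by simp
    next
      case 2
      then show ?thesis
        using j(3) ends assms(4)[of \<xi>] by simp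
    next
      case 3
      then have "nodes R m j < \<xi>" "\<xi> \<le> nodes R m j + 2 * R / real (Suc m)"
        using j(3,4) ends nodes_Suc[of R m j] by auto
      then show ?thesis
        using mesh by linarith
    qed
    then show ?thesis
      using d(2)[of "nodes R m j"] j(2) \<open>0 < e\<close> by (auto simp: dist_real_def)
  qed
  then show "\<exists>m\<^sub>0. \<forall>m\<ge>m\<^sub>0. norm (stair k (nodes R m) (Suc m) \<xi> - k \<xi>) < e"
    by blast
qed

lemma stair_measurable [measurable]: "stair k g n \<in> borel_measurable borel"
  unfolding stair_def[abs_def] of_bool_def by measurable

lemma AE_slope_not_in:
  assumes "countable D"
  shows "AE z in lborel. 0 < snd z \<longrightarrow> (fst z - x0) / snd z \<notin> (D :: real set)"
proof -
  have "AE z in lborel. \<not> (0 < snd z \<and> (fst z - x0) / snd z = d)" for d :: real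
  proof -
    let ?N = "{z::real \<times> real. (1, - d) \<bullet> z = x0}"
    have "negligible ?N"
      by (rule negligible_hyperplane) (simp add: zero_prod_def)
    moreover have "closed ?N"
      by (rule closed_hyperplane)
    ultimately have "?N \<in> null_sets lborel"
      by (simp add: negligible_iff_null_sets null_sets_completion_iff)
    then have "AE z in lborel. z \<notin> ?N"
      by (rule AE_not_in)
    then show ?thesis
      by eventually_elim (auto simp: inner_prod_def field_simps)
  qed
  then have "AE z in lborel. \<forall>d\<in>D. \<not> (0 < snd z \<and> (fst z - x0) / snd z = d)"
    by (subst AE_ball_countable[OF assms]) blast
  then show ?thesis
    by eventually_elim auto
qed

lemma self_similar_measurable:
  assumes [measurable]: "k \<in> borel_measurable borel"
  shows "(\<lambda>z::real \<times> real. k ((fst z - x0) / snd z)) \<in> borel_measurable borel"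
  unfolding borel_prod[symmetric] by measurable

section \<open>The weak formulation for a monotone self-similar profile\<close>

context test_fun
begin

text \<open>The integrals are evaluated for staircases and the limit is taken afterwards. No
  derivative of w appears, so shocks and rarefactions need no separate treatment.\<close>

lemma self_similar_weak_solution:
  fixes w F :: "real \<Rightarrow> real"
  assumes "mono w" "0 < R" "\<And>\<xi>. \<xi> \<le> - R \<Longrightarrow> w \<xi> = uL" "\<And>\<xi>. R \<le> \<xi> \<Longrightarrow> w \<xi> = uR"
    and cont: "continuous_on UNIV F"
    and jump: "\<And>\<xi> \<zeta>. \<xi> \<le> \<zeta> \<Longrightarrow> \<xi> * (w \<zeta> - w \<xi>) \<le> F (w \<zeta>) - F (w \<xi>)"
      "\<And>\<xi> \<zeta>. \<xi> \<le> \<zeta> \<Longrightarrow> F (w \<zeta>) - F (w \<xi>) \<le> \<zeta> * (w \<zeta> - w \<xi>)"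
  shows "(LINT z|lborel. indicator {z. 0 < snd z} z *
      (w ((fst z - x0) / snd z) * \<phi>t z + F (w ((fst z - x0) / snd z)) * \<phi>x z)) =
    - (uL * (LINT x|lborel. \<phi> (x, 0)) + (uR - uL) * (LINT x|lborel. indicator {x0<..} x * \<phi> (x, 0)))"
proof -
  define \<xi> where "\<xi> z = (fst z - x0) / snd z" for z :: "real \<times> real"
  define H where "H = {z :: real \<times> real. 0 < snd z}"
  define P where "P = (LINT x|lborel. \<phi> (x, 0))"
  define Q where "Q = (LINT x|lborel. indicator {x0<..} x * \<phi> (x, 0))"
  define C where "C = (LINT z|lborel. \<bar>\<phi>x z\<bar>)"
  define Fw where "Fw = F \<circ> w"
  define I where "I m = (LINT z|lborel. indicator H z *
    (stair w (nodes R m) (Suc m) (\<xi> z) * \<phi>t z + stair Fw (nodes R m) (Suc m) (\<xi> z) * \<phi>x z))" for m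
  have H: "H = ray c UNIV" for c
    by (simp add: H_def ray_def)
  have sets_H: "H \<in> sets borel"
    unfolding H[of 0] by measurable
  have int_x: "integrable lborel (\<lambda>z. indicator A z * \<phi>x z)"
    and int_t: "integrable lborel (\<lambda>z. indicator A z * \<phi>t z)" if "A \<in> sets borel" for A
    using that by (auto intro!: integrable_\<phi>x[of _ 1] integrable_\<phi>t[of _ 1] simp: indicator_def)
  have ray: "(LINT z|lborel. indicator (ray c A) z * \<phi>t z) +
      c * (LINT z|lborel. indicator (ray c A) z * \<phi>x z) = - (LINT x|lborel. indicator A x * \<phi> (x, 0))"
    if "A \<in> sets borel" for c A
  proof -
    have "(LINT z|lborel. indicator (ray c A) z * (\<phi>t z + c * \<phi>x z)) =
        (LINT z|lborel. indicator (ray c A) z * \<phi>t z + c * (indicator (ray c A) z * \<phi>x z))"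
      by (simp add: algebra_simps)
    also have "\<dots> = (LINT z|lborel. indicator (ray c A) z * \<phi>t z) +
        c * (LINT z|lborel. indicator (ray c A) z * \<phi>x z)"
      using int_x[OF sets_ray[OF that]] int_t[OF sets_ray[OF that]]
      by (subst Bochner_Integration.integral_add) auto
    finally show ?thesis
      using ray_integral[OF that] by simp
  qed
  have plane_t: "(LINT z|lborel. indicator H z * \<phi>t z) = - P"
    using ray[of UNIV 0] by (simp add: H[of 0] P_def)
  \<comment> \<open>The half plane is a \<open>ray\<close> set in every frame; comparing c = 0 with
    c = 1 isolates the integral of \<open>\<phi>x\<close>.\<close>
  then have plane_x: "(LINT z|lborel. indicator H z * \<phi>x z) = 0"
    using ray[of UNIV 1] by (simp add: H[symmetric] P_def)
  have I_bound: "\<bar>I m + (uL * P + (uR - uL) * Q)\<bar> \<le> 2 * R / real (Suc m) * ((uR - uL) * C)" for m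
  proof -
    define g where "g = nodes R m"
    define d where "d i = w (g (Suc i)) - w (g i)" for i
    define e where "e i = F (w (g (Suc i))) - F (w (g i))" for i
    define r where "r i = ray (g (Suc i)) {x0<..}" for i
    have ends: "g 0 = - R" "g (Suc m) = R"
      by (simp_all add: g_def nodes_def)
    have step: "g (Suc i) = g i + 2 * R / real (Suc m)" for i
      unfolding g_def by (rule nodes_Suc)
    have inc: "g i \<le> g (Suc i)" for i
      using step assms(2) by simp
    have d0: "0 \<le> d i" for i
      using assms(1) inc by (simp add: d_def mono_def)
    have sum_d: "(\<Sum>i<Suc m. d i) = uR - uL"
      unfolding d_def by (subst sum_lessThan_telescope) (use assms(3,4) ends in simp)
    have sets_r: "r i \<in> sets borel" for i
      unfolding r_def by measurable
    have in_r: "indicator H z * of_bool (g (Suc i) < \<xi> z) = (indicator (r i) z :: real)" for i z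
      by (auto simp: H_def r_def ray_def \<xi>_def indicator_def field_simps)
    have expand: "indicator H z * (stair w g (Suc m) (\<xi> z) * \<phi>t z + stair Fw g (Suc m) (\<xi> z) * \<phi>x z) =
        uL * (indicator H z * \<phi>t z) + F uL * (indicator H z * \<phi>x z) +
        (\<Sum>i<Suc m. d i * (indicator (r i) z * \<phi>t z) + e i * (indicator (r i) z * \<phi>x z))" for z
    proof -
      have w: "stair w g (Suc m) (\<xi> z) = uL + (\<Sum>i<Suc m. d i * of_bool (g (Suc i) < \<xi> z))"
        unfolding stair_def d_def using assms(3) ends by simp
      have F: "stair Fw g (Suc m) (\<xi> z) = F uL + (\<Sum>i<Suc m. e i * of_bool (g (Suc i) < \<xi> z))"
        unfolding stair_def e_def Fw_def using assms(3) ends by simp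
      show ?thesis
        unfolding w F in_r[symmetric] sum.distrib
        by (simp only: ring_distribs sum_distrib_left sum_distrib_right ac_simps)
    qed
    have "I m = uL * (LINT z|lborel. indicator H z * \<phi>t z) + F uL * (LINT z|lborel. indicator H z * \<phi>x z) +
        (\<Sum>i<Suc m. d i * (LINT z|lborel. indicator (r i) z * \<phi>t z) +
          e i * (LINT z|lborel. indicator (r i) z * \<phi>x z))"
      unfolding I_def g_def[symmetric] expand
      using int_x[OF sets_H] int_t[OF sets_H] int_x[OF sets_r] int_t[OF sets_r]
      by (simp del: sum.lessThan_Suc)
    also have "(\<Sum>i<Suc m. d i * (LINT z|lborel. indicator (r i) z * \<phi>t z) +
          e i * (LINT z|lborel. indicator (r i) z * \<phi>x z)) =
        (\<Sum>i<Suc m. d i * (- Q) + (e i - g (Suc i) * d i) * (LINT z|lborel. indicator (r i) z * \<phi>x z))"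
    proof (rule sum.cong[OF refl])
      fix i
      \<comment> \<open>In the frame of the node the time derivative is traded for the space
        derivative and the initial term Q; what remains is the Rankine-Hugoniot defect of the
        jump.\<close>
      have *: "(LINT z|lborel. indicator (r i) z * \<phi>t z) =
          - Q - g (Suc i) * (LINT z|lborel. indicator (r i) z * \<phi>x z)"
        using ray[of "{x0<..}" "g (Suc i)"] by (simp add: r_def Q_def)
      show "d i * (LINT z|lborel. indicator (r i) z * \<phi>t z) +
          e i * (LINT z|lborel. indicator (r i) z * \<phi>x z) =
          d i * (- Q) + (e i - g (Suc i) * d i) * (LINT z|lborel. indicator (r i) z * \<phi>x z)"
        unfolding * by (simp only: ring_distribs) simp
    qed
    also have "\<dots> = - ((uR - uL) * Q) +
        (\<Sum>i<Suc m. (e i - g (Suc i) * d i) * (LINT z|lborel. indicator (r i) z * \<phi>x z))"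
      unfolding sum.distrib sum_distrib_right[symmetric] sum_d by simp
    finally have "I m + (uL * P + (uR - uL) * Q) =
        (\<Sum>i<Suc m. (e i - g (Suc i) * d i) * (LINT z|lborel. indicator (r i) z * \<phi>x z))"
      by (simp add: plane_t plane_x)
    also have "\<bar>\<dots>\<bar> \<le> (\<Sum>i<Suc m. \<bar>(e i - g (Suc i) * d i) * (LINT z|lborel. indicator (r i) z * \<phi>x z)\<bar>)"
      by (rule sum_abs)
    also have "\<dots> \<le> (\<Sum>i<Suc m. (2 * R / real (Suc m) * d i) * C)"
    proof (rule sum_mono)
      fix i
      \<comment> \<open>The jump satisfies the Rankine-Hugoniot condition for some speed between the
        two nodes, so at the right node it misses by at most the cell width times the jump.\<close>
      have "g i * d i \<le> e i" "e i \<le> g (Suc i) * d i"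
        using jump[OF inc] by (auto simp: d_def e_def)
      then have "\<bar>e i - g (Suc i) * d i\<bar> \<le> 2 * R / real (Suc m) * d i"
        unfolding step by (simp add: algebra_simps)
      moreover have "\<bar>LINT z|lborel. indicator (r i) z * \<phi>x z\<bar> \<le> C"
      proof -
        have "\<bar>LINT z|lborel. indicator (r i) z * \<phi>x z\<bar> \<le> (LINT z|lborel. \<bar>indicator (r i) z * \<phi>x z\<bar>)"
          by (rule integral_abs_bound)
        also have "\<dots> \<le> C"
          unfolding C_def using int_x[OF sets_r] int_x[of UNIV]
          by (intro integral_mono integrable_abs) (auto simp: indicator_def)
        finally show ?thesis .
      qed
      moreover have "0 \<le> 2 * R / real (Suc m) * d i"
        using d0 assms(2) by simp
      ultimately show "\<bar>(e i - g (Suc i) * d i) * (LINT z|lborel. indicator (r i) z * \<phi>x z)\<bar>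
          \<le> (2 * R / real (Suc m) * d i) * C"
        unfolding abs_mult by (intro mult_mono) auto
    qed
    also have "\<dots> = 2 * R / real (Suc m) * ((uR - uL) * C)"
      unfolding sum_d[symmetric] by (simp only: sum_distrib_left sum_distrib_right ac_simps)
    finally show ?thesis .
  qed
  have "(\<lambda>m. I m + (uL * P + (uR - uL) * Q)) \<longlonglongrightarrow> 0"
  proof (rule Lim_null_comparison)
    show "\<forall>\<^sub>F m in sequentially. norm (I m + (uL * P + (uR - uL) * Q))
        \<le> 2 * R / real (Suc m) * ((uR - uL) * C)"
      using I_bound by simp
    have "(\<lambda>m. 2 * R * ((uR - uL) * C) * (1 / real (Suc m))) \<longlonglongrightarrow> 2 * R * ((uR - uL) * C) * 0"
      by (intro tendsto_mult tendsto_const LIMSEQ_Suc lim_1_over_n)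
    then show "(\<lambda>m. 2 * R / real (Suc m) * ((uR - uL) * C)) \<longlonglongrightarrow> 0"
      by (simp add: field_simps)
  qed
  then have lim: "I \<longlonglongrightarrow> - (uL * P + (uR - uL) * Q)"
    by (intro LIM_zero_cancel[of I]) (simp add: algebra_simps)
  have w_bounds: "uL \<le> w \<zeta>" "w \<zeta> \<le> uR" for \<zeta>
    using monoD[OF assms(1), of "min \<zeta> (- R)" \<zeta>] monoD[OF assms(1), of \<zeta> "max \<zeta> R"] assms(3,4)
    by auto
  have "compact (F ` {uL..uR})"
    by (intro compact_continuous_image continuous_on_subset[OF cont]) auto
  then obtain B where B: "\<And>v. v \<in> {uL..uR} \<Longrightarrow> \<bar>F v\<bar> \<le> B"
    using compact_imp_bounded[of "F ` {uL..uR}"] unfolding bounded_iff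
    by (metis image_eqI real_norm_def)
  define A where "A = max \<bar>uL\<bar> \<bar>uR\<bar>"
  have "w \<in> borel_measurable borel"
    using assms(1) by (rule borel_measurable_mono)
  moreover have "F \<in> borel_measurable borel"
    using cont by (rule borel_measurable_continuous_onI)
  ultimately have meas: "w \<in> borel_measurable borel" "Fw \<in> borel_measurable borel"
    by (auto simp: Fw_def)
  have \<phi>_meas: "\<phi>x \<in> borel_measurable borel" "\<phi>t \<in> borel_measurable borel"
    using cont_x cont_t by (auto intro: borel_measurable_continuous_onI)
  have "I \<longlonglongrightarrow> (LINT z|lborel. indicator H z * (w (\<xi> z) * \<phi>t z + Fw (\<xi> z) * \<phi>x z))"
    unfolding I_def
  proof (rule integral_dominated_convergence[where w = "\<lambda>z. A * \<bar>\<phi>t z\<bar> + B * \<bar>\<phi>x z\<bar>"])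
    show "(\<lambda>z. indicator H z * (w (\<xi> z) * \<phi>t z + Fw (\<xi> z) * \<phi>x z)) \<in> borel_measurable lborel"
      using self_similar_measurable[OF meas(1)] self_similar_measurable[OF meas(2)] sets_H \<phi>_meas
      by (simp add: \<xi>_def)
    show "(\<lambda>z. indicator H z * (stair w (nodes R m) (Suc m) (\<xi> z) * \<phi>t z +
        stair Fw (nodes R m) (Suc m) (\<xi> z) * \<phi>x z)) \<in> borel_measurable lborel" for m
      using self_similar_measurable[OF stair_measurable, of w "nodes R m" "Suc m" x0]
        self_similar_measurable[OF stair_measurable, of Fw "nodes R m" "Suc m" x0] sets_H \<phi>_meas
      by (simp add: \<xi>_def)
    show "integrable lborel (\<lambda>z. A * \<bar>\<phi>t z\<bar> + B * \<bar>\<phi>x z\<bar>)"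
      using int_x[of UNIV] int_t[of UNIV] by simp
    \<comment> \<open>The discontinuities of w sit on countably many rays, a null set; elsewhere
      \<open>stair_tendsto\<close> applies.\<close>
    have "countable {\<zeta>. \<not> isCont w \<zeta>}"
      using assms(1) by (rule mono_ctble_discont)
    then have "AE z in lborel. 0 < snd z \<longrightarrow> \<xi> z \<notin> {\<zeta>. \<not> isCont w \<zeta>}"
      unfolding \<xi>_def by (rule AE_slope_not_in)
    then show "AE z in lborel. (\<lambda>m. indicator H z * (stair w (nodes R m) (Suc m) (\<xi> z) * \<phi>t z +
        stair Fw (nodes R m) (Suc m) (\<xi> z) * \<phi>x z)) \<longlonglongrightarrow>
        indicator H z * (w (\<xi> z) * \<phi>t z + Fw (\<xi> z) * \<phi>x z)"
    proof eventually_elim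
      case (elim z)
      show ?case
      proof (cases "z \<in> H")
        case True
        then have c: "isCont w (\<xi> z)"
          using elim by (simp add: H_def)
        moreover have "isCont F (w (\<xi> z))"
          using cont by (simp add: continuous_on_eq_continuous_at)
        ultimately have "isCont Fw (\<xi> z)"
          unfolding Fw_def by (rule continuous_at_compose)
        then show ?thesis
          using c assms(2-4) by (intro tendsto_intros stair_tendsto) (auto simp: Fw_def)
      qed simp
    qed
    show "AE z in lborel. norm (indicator H z * (stair w (nodes R m) (Suc m) (\<xi> z) * \<phi>t z +
        stair Fw (nodes R m) (Suc m) (\<xi> z) * \<phi>x z)) \<le> A * \<bar>\<phi>t z\<bar> + B * \<bar>\<phi>x z\<bar>" for m
    proof (rule AE_I2)
      fix z
      let ?s = "stair w (nodes R m) (Suc m) (\<xi> z)" and ?f = "stair Fw (nodes R m) (Suc m) (\<xi> z)"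
      obtain i j where "?s = w (nodes R m i)" "?f = Fw (nodes R m j)"
        using stair_value[OF incseq_nodes[OF assms(2)]] by metis
      then have "\<bar>?s\<bar> \<le> A" "\<bar>?f\<bar> \<le> B"
        using w_bounds[of "nodes R m i"] w_bounds[of "nodes R m j"] B by (auto simp: A_def Fw_def)
      then have "\<bar>?s * \<phi>t z\<bar> \<le> A * \<bar>\<phi>t z\<bar>" "\<bar>?f * \<phi>x z\<bar> \<le> B * \<bar>\<phi>x z\<bar>"
        by (auto simp: abs_mult intro!: mult_right_mono)
      then show "norm (indicator H z * (?s * \<phi>t z + ?f * \<phi>x z)) \<le> A * \<bar>\<phi>t z\<bar> + B * \<bar>\<phi>x z\<bar>"
        by (auto simp: indicator_def)
    qed
  qed
  from LIMSEQ_unique[OF this lim] show ?thesis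
    by (simp add: H_def \<xi>_def Fw_def P_def Q_def)
qed

end

section \<open>From generated curves to a weak solution\<close>

context riemann_problem
begin

text \<open>On shock rays \<open>u\<close> is arbitrary between uL and uR, so it is Lebesgue but
  perhaps not Borel measurable. The integrals are computed for an arbitrary selection w of contact
  points, which is monotone and thus Borel, and transferred almost everywhere.\<close>

lemma self_similar_contact_weak_solution:
  assumes u0: "\<And>x. x < x0 \<Longrightarrow> u0 x = uL" "\<And>x. x > x0 \<Longrightarrow> u0 x = uR"
    and bounds: "\<And>x t. 0 < t \<Longrightarrow> uL \<le> u x t \<and> u x t \<le> uR"
    and contact: "\<And>x t. 0 < t \<Longrightarrow> (x - x0) / t \<notin> shock_speeds \<Longrightarrow> u x t \<in> contact ((x - x0) / t)"
  shows "weak_solution F u0 u"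
proof -
  define w where "w \<xi> = (SOME v. v \<in> contact \<xi>)" for \<xi>
  have w: "w \<xi> \<in> contact \<xi>" for \<xi>
    unfolding w_def using contact_nonempty by (rule someI_ex)
  have "mono w"
    by (rule monoI) (metis w contact_mono order_le_less order_refl)
  obtain R where R: "0 < R" "\<And>\<xi>. \<xi> \<le> - R \<Longrightarrow> w \<xi> = uL" "\<And>\<xi>. R \<le> \<xi> \<Longrightarrow> w \<xi> = uR"
  proof -
    obtain R1 R2 where R12: "\<And>\<xi>. \<xi> \<le> R1 \<Longrightarrow> contact \<xi> = {uL}" "\<And>\<xi>. R2 \<le> \<xi> \<Longrightarrow> contact \<xi> = {uR}"
      using contact_left_end contact_right_end by blast
    show ?thesis
    proof (rule that[of "max 1 (max (- R1) R2)"])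
      show "w \<xi> = uL" if "\<xi> \<le> - max 1 (max (- R1) R2)" for \<xi>
        using R12(1)[of \<xi>] w[of \<xi>] that by auto
      show "w \<xi> = uR" if "max 1 (max (- R1) R2) \<le> \<xi>" for \<xi>
        using R12(2)[of \<xi>] w[of \<xi>] that by auto
    qed simp
  qed
  \<comment> \<open>Minimality of \<open>w \<xi>\<close> tested with \<open>w \<zeta>\<close>, and
    conversely.\<close>
  have jump: "\<xi> * (w \<zeta> - w \<xi>) \<le> F (w \<zeta>) - F (w \<xi>)" "F (w \<zeta>) - F (w \<xi>) \<le> \<zeta> * (w \<zeta> - w \<xi>)" for \<xi> \<zeta>
    using contactD(3)[OF w[of \<xi>], of "w \<zeta>"] contactD(3)[OF w[of \<zeta>], of "w \<xi>"]
      contactD(1,2)[OF w[of \<xi>]] contactD(1,2)[OF w[of \<zeta>]]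
    by (auto simp: algebra_simps)
  let ?\<Omega> = "UNIV \<times> {0<..} :: (real \<times> real) set"
  have \<Omega>: "?\<Omega> = {z. 0 < snd z}"
    by auto
  have \<Omega>_borel: "?\<Omega> \<in> sets borel"
    unfolding \<Omega> by (intro borel_open open_Collect_less continuous_intros)
  then have \<Omega>_lebesgue: "?\<Omega> \<in> sets lebesgue"
    by auto
  have ae: "AE z in lebesgue. 0 < snd z \<longrightarrow> u (fst z) (snd z) = w ((fst z - x0) / snd z)"
  proof -
    have "AE z in lborel. 0 < snd z \<longrightarrow> (fst z - x0) / snd z \<notin> shock_speeds"
      by (rule AE_slope_not_in[OF countable_shock_speeds])
    then have "AE z in lborel. 0 < snd z \<longrightarrow> u (fst z) (snd z) = w ((fst z - x0) / snd z)"
      by eventually_elim (use contact_unique contact w in blast)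
    then show ?thesis
      by (rule AE_completion)
  qed
  have w_meas: "w \<in> borel_measurable borel"
    using \<open>mono w\<close> by (rule borel_measurable_mono)
  have F_meas: "F \<in> borel_measurable borel"
    by (rule borel_measurable_continuous_onI[OF continuous_on_F])
  have W_meas: "(\<lambda>z. w ((fst z - x0) / snd z)) \<in> borel_measurable borel"
    by (rule self_similar_measurable[OF w_meas])
  have FW_meas: "(\<lambda>z. F (w ((fst z - x0) / snd z))) \<in> borel_measurable borel"
    using measurable_compose[OF W_meas F_meas] .
  show ?thesis
    unfolding weak_solution_def
  proof (intro conjI allI impI)
    have "(\<lambda>z. indicator ?\<Omega> z * w ((fst z - x0) / snd z)) \<in> borel_measurable lebesgue"
      using W_meas \<Omega>_borel by (intro measurable_completion) simp
    moreover have "AE z in lebesgue. indicator ?\<Omega> z * w ((fst z - x0) / snd z) =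
        (if z \<in> ?\<Omega> then u (fst z) (snd z) else 0)"
      using ae by eventually_elim (auto simp: \<Omega>)
    ultimately have "(\<lambda>z. if z \<in> ?\<Omega> then u (fst z) (snd z) else 0) \<in> borel_measurable lebesgue"
      by (rule borel_measurable_AE)
    then show "(\<lambda>(x, t). u x t) \<in> borel_measurable (lebesgue_on ?\<Omega>)"
      unfolding split_def by (rule borel_measurable_if[OF \<Omega>_lebesgue, THEN iffD1])
    show "\<exists>B. \<forall>x. \<forall>t>0. \<bar>u x t\<bar> \<le> B"
      using bounds by (intro exI[of _ "max \<bar>uL\<bar> \<bar>uR\<bar>"]) (smt (verit, best))
  next
    fix \<phi> \<phi>x \<phi>t assume "test_function \<phi> \<phi>x \<phi>t"
    then interpret test_fun \<phi> \<phi>x \<phi>t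
      by unfold_locales
    let ?W = "\<lambda>z. indicator {z. 0 < snd z} z *
      (w ((fst z - x0) / snd z) * \<phi>t z + F (w ((fst z - x0) / snd z)) * \<phi>x z)"
    let ?U = "\<lambda>z. indicator ?\<Omega> z *\<^sub>R (u (fst z) (snd z) * \<phi>t z + F (u (fst z) (snd z)) * \<phi>x z)"
    have \<phi>_meas: "\<phi>x \<in> borel_measurable borel" "\<phi>t \<in> borel_measurable borel"
      using cont_x cont_t by (auto intro: borel_measurable_continuous_onI)
    have meas: "?W \<in> borel_measurable lborel"
      using W_meas FW_meas \<phi>_meas \<Omega>_borel by (simp add: \<Omega>)
    have eq: "AE z in lebesgue. ?W z = ?U z"
      using ae by eventually_elim (auto simp: \<Omega> indicator_def)
    have "(LINT (x, t)|lebesgue_on ?\<Omega>. u x t * \<phi>t (x, t) + F (u x t) * \<phi>x (x, t)) = (LINT z|lebesgue. ?U z)"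
      using \<Omega>_lebesgue by (subst integral_restrict_space) (auto simp: split_def)
    also have "\<dots> = (LINT z|lebesgue. ?W z)"
      using borel_measurable_AE[OF measurable_completion[OF meas] eq] measurable_completion[OF meas] eq
      by (intro integral_cong_AE) (auto elim: eventually_mono)
    also have "\<dots> = (LINT z|lborel. ?W z)"
      by (rule integral_completion[OF meas])
    also have "\<dots> = - (uL * (LINT x|lborel. \<phi> (x, 0)) +
        (uR - uL) * (LINT x|lborel. indicator {x0<..} x * \<phi> (x, 0)))"
      by (rule self_similar_weak_solution[OF \<open>mono w\<close> R continuous_on_F jump])
    finally have left: "(LINT (x, t)|lebesgue_on ?\<Omega>. u x t * \<phi>t (x, t) + F (u x t) * \<phi>x (x, t)) =
      - (uL * (LINT x|lborel. \<phi> (x, 0)) + (uR - uL) * (LINT x|lborel. indicator {x0<..} x * \<phi> (x, 0)))" .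
    have int: "integrable lborel (\<lambda>x. \<phi> (x, 0))" "integrable lborel (\<lambda>x. indicator {x0<..} x * \<phi> (x, 0))"
      using integrable_\<phi>_0[of UNIV] integrable_\<phi>_0[of "{x0<..}"] by simp_all
    have "(LINT x|lebesgue. u0 x * \<phi> (x, 0)) =
        (LINT x|lebesgue. uL * \<phi> (x, 0) + (uR - uL) * (indicator {x0<..} x * \<phi> (x, 0)))"
    proof (rule integral_discrete_difference[where X = "{x0}"])
      show "u0 x * \<phi> (x, 0) = uL * \<phi> (x, 0) + (uR - uL) * (indicator {x0<..} x * \<phi> (x, 0))"
        if "x \<notin> {x0}" for x
        using u0[of x] that by (cases "x < x0") (auto simp: algebra_simps)
    qed auto
    also have "\<dots> = (LINT x|lborel. uL * \<phi> (x, 0) + (uR - uL) * (indicator {x0<..} x * \<phi> (x, 0)))"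
      using int by (intro integral_completion) simp
    also have "\<dots> = uL * (LINT x|lborel. \<phi> (x, 0)) +
        (uR - uL) * (LINT x|lborel. indicator {x0<..} x * \<phi> (x, 0))"
      using int by simp
    finally show "(LINT (x, t)|lebesgue_on ?\<Omega>. u x t * \<phi>t (x, t) + F (u x t) * \<phi>x (x, t)) +
        (LINT x|lebesgue. u0 x * \<phi> (x, 0)) = 0"
      using left by simp
  qed
qed

end

text \<open>The algorithm is a relation with free choices, so correctness is stated for every
  outcome and existence separately. At a shock the curve contains a whole segment; hence a solution
  is any \<open>u\<close> that picks points of generated curves, where the run may depend on the
  time.\<close>

theorem theorem3p11:
  fixes F :: "real \<Rightarrow> real" and u0 :: "real \<Rightarrow> real" and x0 uL uR :: real
  assumes "smooth F" and "uL < uR"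
    and "\<And>x. x < x0 \<Longrightarrow> u0 x = uL" and "\<And>x. x > x0 \<Longrightarrow> u0 x = uR"
  shows "(\<forall>\<tau>>0. \<forall>K V. geap F x0 uL uR \<tau> (K, V) \<longrightarrow>
            (\<forall>(y, a, b)\<in>V. hull_secant F uL uR a b) \<and>
            (\<forall>p\<in>K. LconF F uL uR (flow_u uL uR p) = F (flow_u uL uR p)) \<and>
            (\<forall>h\<in>{uL..uR}. \<exists>x. (x, h) \<in> curve_points F x0 uL uR \<tau> (K, V)) \<and>
            (\<forall>x. \<exists>h. (x, h) \<in> curve_points F x0 uL uR \<tau> (K, V)) \<and>
            (\<forall>x. x \<notin> fst ` V \<longrightarrow> (\<exists>!h. (x, h) \<in> curve_points F x0 uL uR \<tau> (K, V)))) \<and>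
         (\<forall>u. (\<forall>\<tau>>0. \<exists>C. geap F x0 uL uR \<tau> C \<and>
                   (\<forall>x. (x, u x \<tau>) \<in> curve_points F x0 uL uR \<tau> C)) \<longrightarrow>
            weak_solution F u0 u) \<and>
         (finite (maximal_hull_secants F uL uR) \<longrightarrow>
            (\<forall>\<tau>>0. \<exists>C. geap F x0 uL uR \<tau> C))"
proof -
  interpret riemann_problem F uL uR
    using assms(1,2) by unfold_locales
  have flowed: "flowed_curve F uL uR \<tau>" if "0 < \<tau>" for \<tau>
    using that by unfold_locales
  show ?thesis
  proof (intro conjI)
    show "\<forall>\<tau>>0. \<forall>K V. geap F x0 uL uR \<tau> (K, V) \<longrightarrow>
            (\<forall>(y, a, b)\<in>V. hull_secant F uL uR a b) \<and>
            (\<forall>p\<in>K. LconF F uL uR (flow_u uL uR p) = F (flow_u uL uR p)) \<and>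
            (\<forall>h\<in>{uL..uR}. \<exists>x. (x, h) \<in> curve_points F x0 uL uR \<tau> (K, V)) \<and>
            (\<forall>x. \<exists>h. (x, h) \<in> curve_points F x0 uL uR \<tau> (K, V)) \<and>
            (\<forall>x. x \<notin> fst ` V \<longrightarrow> (\<exists>!h. (x, h) \<in> curve_points F x0 uL uR \<tau> (K, V)))"
    proof (intro allI impI)
      fix \<tau> :: real and K V
      assume "0 < \<tau>" and geap: "geap F x0 uL uR \<tau> (K, V)"
      interpret flowed_curve F uL uR x0 \<tau>
        by (rule flowed[OF \<open>0 < \<tau>\<close>])
      have res: "resolved K V"
        using geap_resolved[OF geap] by simp
      have covers: "\<exists>h. (x, h) \<in> points (K, V)" for x
      proof -
        obtain v where "v \<in> contact ((x - x0) / \<tau>)"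
          using contact_nonempty by blast
        from resolved_covers_contact[OF res this] show ?thesis
          using \<open>0 < \<tau>\<close> by auto
      qed
      then have "\<exists>!h. (x, h) \<in> points (K, V)" if "x \<notin> fst ` V" for x
        using resolved_unique[OF res that] by blast
      then show "(\<forall>(y, a, b)\<in>V. hull_secant F uL uR a b) \<and>
            (\<forall>p\<in>K. LconF F uL uR (flow_u uL uR p) = F (flow_u uL uR p)) \<and>
            (\<forall>h\<in>{uL..uR}. \<exists>x. (x, h) \<in> curve_points F x0 uL uR \<tau> (K, V)) \<and>
            (\<forall>x. \<exists>h. (x, h) \<in> curve_points F x0 uL uR \<tau> (K, V)) \<and>
            (\<forall>x. x \<notin> fst ` V \<longrightarrow> (\<exists>!h. (x, h) \<in> curve_points F x0 uL uR \<tau> (K, V)))"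
        using covers resolved_shock_hull_secant[OF res] resolved_kept_hull[OF res]
          resolved_covers_height[OF res] by auto
    qed
    show "\<forall>u. (\<forall>\<tau>>0. \<exists>C. geap F x0 uL uR \<tau> C \<and>
                   (\<forall>x. (x, u x \<tau>) \<in> curve_points F x0 uL uR \<tau> C)) \<longrightarrow>
            weak_solution F u0 u"
    proof (intro allI impI)
      fix u :: "real \<Rightarrow> real \<Rightarrow> real"
      assume sol: "\<forall>\<tau>>0. \<exists>C. geap F x0 uL uR \<tau> C \<and> (\<forall>x. (x, u x \<tau>) \<in> curve_points F x0 uL uR \<tau> C)"
      have point: "uL \<le> u x t \<and> u x t \<le> uR \<and>
          ((x - x0) / t \<notin> shock_speeds \<longrightarrow> u x t \<in> contact ((x - x0) / t))" if t: "0 < t" for x t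
      proof -
        interpret flowed_curve F uL uR x0 t
          by (rule flowed[OF t])
        obtain C where "geap F x0 uL uR t C" "(x, u x t) \<in> points C"
          using sol t by blast
        then obtain K V where C: "geap F x0 uL uR t (K, V)" "(x, u x t) \<in> points (K, V)"
          by (cases C) simp
        have res: "resolved K V"
          using geap_resolved[OF C(1)] by simp
        have "(x0 + (x - x0) / t * t, u x t) \<in> points (K, V)"
          using C(2) t by simp
        then show ?thesis
          using resolved_point_bounds[OF res C(2)] resolved_point_contact[OF res] by blast
      qed
      show "weak_solution F u0 u"
        by (rule self_similar_contact_weak_solution) (use assms(3,4) point in auto)
    qed
    show "finite (maximal_hull_secants F uL uR) \<longrightarrow> (\<forall>\<tau>>0. \<exists>C. geap F x0 uL uR \<tau> C)"
      using flowed_curve.geap_exists[OF flowed] by blast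
  qed
qed

end
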